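(* Let $f\colon T\to J$ be a stable simplicial map from a tree $T$ to a path graph $J$. Then the following statements are equivalent: (1) there are no 2-obstructors for $f$; (2) $|f|$ lifts to an embedding.
   Context: Trees and graphs here are finite and regarded as one-dimensional simplicial complexes; a path graph is a triangulation of a segment. $|K|$ denotes the geometric realisation and $|f|$ the piecewise linear map induced by a simplicial map $f$. $|f|\colon|T|\to|J|$ lifts to an embedding if there is a piecewise linear embedding $\widetilde{|f|}\colon|T|\to|J|\times\mathbb{R}$ with $|f|=\mathrm{pr}_{|J|}\circ\widetilde{|f|}$. Let $f\colon G\to H$ be a simplicial map between graphs. A vertex $v$ of $G$ is regular with respect to $f$ if $f$ is bijective on the star $\mathrm{st}(v)=\bigcup_{e\in E(G),\,v\in e}e$ (that is, $f$ maps $\mathrm{st}(v)$ bijectively onto $\mathrm{st}(f(v))$). The map $f$ is stable if for any vertex $w\in V(H)$: if $\deg(w)\ne2$, all the vertices in $f^{-1}(w)$ are regular; if $\deg(w)=2$, $f^{-1}(w)$ contains at most one non-regular vertex. (A stable map is injective on each edge.) For a simplicial map $f\colon G\to H$ injective on each simplex, $G^{(2)}_f$ is the graph whose vertices are ordered pairs of distinct vertices of $G$ with the same image under $f$, and where $(a,b)$ and $(a',b')$ are joined by an edge if $\{a,a'\}$ and $\{b,b'\}$ are edges of $G$ (with the same image under $f$). A 2-obstructor for $f$ is a vertex $(x_1,x_2)\in G^{(2)}_f$ together with a path in $G^{(2)}_f$ from $(x_1,x_2)$ to $(x_2,x_1)$. *)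

theory Defs
  imports "HOL-Analysis.Analysis"
begin

record 'a graph =
  verts :: "'a set"
  edges :: "'a set set"

definition simple_graph :: "'a graph \<Rightarrow> bool" where
  "simple_graph G \<longleftrightarrow> finite (verts G) \<and> (\<forall>e\<in>edges G. e \<subseteq> verts G \<and> card e = 2)"

definition degree :: "'a graph \<Rightarrow> 'a \<Rightarrow> nat" where
  "degree G v = card {e \<in> edges G. v \<in> e}"

text \<open>Edge paths may repeat vertices; a one-element list is a path of length zero.\<close>

definition edge_path :: "'a graph \<Rightarrow> 'a list \<Rightarrow> bool" where
  "edge_path G p \<longleftrightarrow>
     p \<noteq> [] \<and> set p \<subseteq> verts G \<and> successively (\<lambda>u v. {u, v} \<in> edges G) p"

definition connected_graph :: "'a graph \<Rightarrow> bool" where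
  "connected_graph G \<longleftrightarrow> verts G \<noteq> {} \<and>
     (\<forall>u\<in>verts G. \<forall>v\<in>verts G. \<exists>p. edge_path G p \<and> hd p = u \<and> last p = v)"

definition cycle :: "'a graph \<Rightarrow> 'a list \<Rightarrow> bool" where
  "cycle G c \<longleftrightarrow> edge_path G c \<and> distinct c \<and> 3 \<le> length c \<and> {last c, hd c} \<in> edges G"

definition tree_graph :: "'a graph \<Rightarrow> bool" where
  "tree_graph G \<longleftrightarrow> simple_graph G \<and> connected_graph G \<and> (\<nexists>c. cycle G c)"

text \<open>The one-vertex graph is admitted as a (degenerate) path graph.\<close>

definition path_graph :: "'a graph \<Rightarrow> bool" where
  "path_graph G \<longleftrightarrow> (\<exists>p. p \<noteq> [] \<and> distinct p \<and> verts G = set p \<and>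
     edges G = {{p ! i, p ! Suc i} | i. Suc i < length p})"

definition simplices :: "'a graph \<Rightarrow> 'a set set" where
  "simplices G = (\<lambda>v. {v}) ` verts G \<union> edges G"

definition simplicial_map :: "('a \<Rightarrow> 'b) \<Rightarrow> 'a graph \<Rightarrow> 'b graph \<Rightarrow> bool" where
  "simplicial_map f G H \<longleftrightarrow> (\<forall>s\<in>simplices G. f ` s \<in> simplices H)"

text \<open>
  The star is represented by its vertex set. A simplicial map is bijective between the
  geometric stars iff it is bijective between these vertex sets, because the edges of a star
  are exactly the pairs formed by the centre and one other vertex.
\<close>

definition star :: "'a graph \<Rightarrow> 'a \<Rightarrow> 'a set" where
  "star G v = \<Union>{e \<in> edges G. v \<in> e}"

definition regular_vertex :: "('a \<Rightarrow> 'b) \<Rightarrow> 'a graph \<Rightarrow> 'b graph \<Rightarrow> 'a \<Rightarrow> bool" where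
  "regular_vertex f G H v \<longleftrightarrow> bij_betw f (star G v) (star H (f v))"

definition stable_map :: "('a \<Rightarrow> 'b) \<Rightarrow> 'a graph \<Rightarrow> 'b graph \<Rightarrow> bool" where
  "stable_map f G H \<longleftrightarrow> (\<forall>w\<in>verts H.
     (degree H w \<noteq> 2 \<longrightarrow> (\<forall>v\<in>verts G. f v = w \<longrightarrow> regular_vertex f G H v)) \<and>
     (degree H w = 2 \<longrightarrow>
        (\<forall>u\<in>verts G. \<forall>v\<in>verts G. f u = w \<longrightarrow> f v = w \<longrightarrow>
           \<not> regular_vertex f G H u \<longrightarrow> \<not> regular_vertex f G H v \<longrightarrow> u = v)))"

definition double_point_graph :: "('a \<Rightarrow> 'b) \<Rightarrow> 'a graph \<Rightarrow> ('a \<times> 'a) graph" where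
  "double_point_graph f G =
     (let V = {(a, b). a \<in> verts G \<and> b \<in> verts G \<and> a \<noteq> b \<and> f a = f b} in
      \<lparr>verts = V,
       edges = {{(a, b), (a', b')} | a b a' b'.
          (a, b) \<in> V \<and> (a', b') \<in> V \<and> {a, a'} \<in> edges G \<and> {b, b'} \<in> edges G \<and>
          f ` {a, a'} = f ` {b, b'}}\<rparr>)"

definition two_obstructor :: "('a \<Rightarrow> 'b) \<Rightarrow> 'a graph \<Rightarrow> 'a \<times> 'a \<Rightarrow> ('a \<times> 'a) list \<Rightarrow> bool" where
  "two_obstructor f G x p \<longleftrightarrow> x \<in> verts (double_point_graph f G) \<and>
     edge_path (double_point_graph f G) p \<and> hd p = x \<and> last p = prod.swap x"

text \<open>
  Geometric realisation by barycentric coordinates: the vertex \<open>v\<close> is placed at the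
  basis vector \<open>axis v 1\<close>, and the map induced by \<open>f\<close> is the linear extension of
  \<open>axis v 1 \<mapsto> axis (f v) 1\<close>.
\<close>

definition realisation :: "'a::finite graph \<Rightarrow> (real ^ 'a) set" where
  "realisation G = (\<Union>s\<in>simplices G. convex hull ((\<lambda>v. axis v 1) ` s))"

definition realisation_map :: "('a::finite \<Rightarrow> 'b::finite) \<Rightarrow> real ^ 'a \<Rightarrow> real ^ 'b" where
  "realisation_map f x = (\<Sum>v\<in>UNIV. (x $ v) *\<^sub>R axis (f v) 1)"

definition affine_map_on :: "'c::real_vector set \<Rightarrow> ('c \<Rightarrow> 'd::real_vector) \<Rightarrow> bool" where
  "affine_map_on C F \<longleftrightarrow> (\<forall>x\<in>C. \<forall>y\<in>C. \<forall>t\<in>{0..1}.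
     F ((1 - t) *\<^sub>R x + t *\<^sub>R y) = (1 - t) *\<^sub>R F x + t *\<^sub>R F y)"

definition piecewise_linear_on :: "'c::real_vector set \<Rightarrow> ('c \<Rightarrow> 'd::real_vector) \<Rightarrow> bool" where
  "piecewise_linear_on X F \<longleftrightarrow>
     (\<exists>\<C>. finite \<C> \<and> X = \<Union>\<C> \<and> (\<forall>C\<in>\<C>. polytope C \<and> affine_map_on C F))"

definition pl_embedding_on ::
    "'c::euclidean_space set \<Rightarrow> 'd::euclidean_space set \<Rightarrow> ('c \<Rightarrow> 'd) \<Rightarrow> bool" where
  "pl_embedding_on X Y F \<longleftrightarrow> F ` X \<subseteq> Y \<and> piecewise_linear_on X F \<and>
     (\<exists>g. homeomorphism X (F ` X) F g)"

definition lifts_to_embedding ::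
    "('a::finite \<Rightarrow> 'b::finite) \<Rightarrow> 'a graph \<Rightarrow> 'b graph \<Rightarrow> bool" where
  "lifts_to_embedding f G H \<longleftrightarrow> (\<exists>F :: real ^ 'a \<Rightarrow> (real ^ 'b) \<times> real.
     pl_embedding_on (realisation G) (realisation H \<times> UNIV) F \<and>
     (\<forall>x\<in>realisation G. realisation_map f x = fst (F x)))"

end

theory Submission
  imports Defs
begin

text \<open>
  A lift amounts to linear orders on the fibres of the vertices of \<open>J\<close> such that two edges of \<open>T\<close>
  over the same edge of \<open>J\<close> never change order, and a lift can then be taken linear in barycentric
  coordinates. If there is no 2-obstructor, every component of the double point graph can be given
  a sign so that swapping changes the sign. The signs define an antisymmetric relation \<open>x\<close> on each
  fibre that is invariant under simultaneous moves; what has to be arranged is transitivity.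

  Call a component of the part of \<open>T\<close> over an interval \<open>[l, h]\<close> of levels spanning if it meets both
  end levels. By a mountain-climbing argument, \<open>x\<close> compares two spanning components consistently.
  A pair of them whose points cannot move to distinct points above level \<open>h\<close> or below level \<open>l\<close>
  is blocked, and the signs within a blocked pair may be changed freely. By descending induction on
  \<open>h - l\<close> one removes all 3-cycles of spanning components: if there are none over longer
  intervals, then \<open>x\<close> is acyclic on the pairs over \<open>[l, h]\<close> that are not blocked, and the signs of the
  blocked pairs are chosen from a linear extension. For \<open>l = h\<close> the components are single vertices.
\<close>

section \<open>Level graphs\<close>

text \<open>Topological sorting: a minimal element gets rank 0 and the ranks of the others are
  shifted up. Injectivity makes the resulting order total on \<open>A\<close>, so that it can later
  decide every blocked pair.\<close>

lemma finite_acyclic_rank: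
  assumes "finite A" "acyclic r"
  shows "\<exists>rank :: 'k \<Rightarrow> nat. inj_on rank A \<and> (\<forall>a\<in>A. \<forall>b\<in>A. (a, b) \<in> r \<longrightarrow> rank a < rank b)"
  using assms(1)
proof (induction "card A" arbitrary: A)
  case (Suc n)
  have "acyclic (r \<inter> A \<times> A)" using acyclic_subset[OF assms(2)] by blast
  then have "wf (r \<inter> A \<times> A)" using Suc.prems by (intro finite_acyclic_wf) auto
  moreover have "\<exists>a. a \<in> A" using Suc.hyps(2) by (cases "A = {}") auto
  ultimately have "\<exists>m\<in>A. \<forall>y. (y, m) \<in> r \<inter> A \<times> A \<longrightarrow> y \<notin> A" by (simp only: wf_eq_minimal) blast
  then obtain m where m: "m \<in> A" "\<And>y. y \<in> A \<Longrightarrow> (y, m) \<notin> r" by blast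
  have "n = card (A - {m})" using Suc m by (simp add: card_Diff_singleton)
  then obtain rank :: "'k \<Rightarrow> nat" where rank: "inj_on rank (A - {m})"
    "\<forall>a\<in>A - {m}. \<forall>b\<in>A - {m}. (a, b) \<in> r \<longrightarrow> rank a < rank b"
    using Suc.hyps(1)[of "A - {m}"] Suc.prems by auto
  have "inj_on (\<lambda>k. if k = m then 0 else Suc (rank k)) A"
    using rank(1) by (auto simp: inj_on_def)
  moreover have "(m, m) \<notin> r" using assms(2) by (auto simp: acyclic_def)
  ultimately show ?case using rank(2) m
    by (intro exI[of _ "\<lambda>k. if k = m then 0 else Suc (rank k)"]) auto
qed simp

text \<open>\<open>adj\<close> stands for the edges of the tree and \<open>lev\<close> for the
  position of the image vertex along the path, so fibres become level sets. Edges inside a level are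
  excluded because a stable map is injective on edges.\<close>

locale level_graph =
  fixes adj :: "'v::finite \<Rightarrow> 'v \<Rightarrow> bool" and lev :: "'v \<Rightarrow> int"
  assumes adj_sym: "adj u v \<Longrightarrow> adj v u"
    and adj_lev: "adj u v \<Longrightarrow> lev v = lev u + 1 \<or> lev v = lev u - 1"
begin

text \<open>\<open>x a b\<close> reads as: \<open>a\<close> lies under \<open>b\<close> in the lift
  to be built. The second clause is invariance along edges of the double point graph, which keeps
  two edges over the same edge from crossing. Transitivity is not part of the notion; it is reached
  only in \<open>ex_rank\<close>.\<close>

definition signing :: "('v \<Rightarrow> 'v \<Rightarrow> bool) \<Rightarrow> bool" where
  "signing x \<longleftrightarrow>
     (\<forall>a b. a \<noteq> b \<longrightarrow> lev a = lev b \<longrightarrow> (x a b \<longleftrightarrow> \<not> x b a)) \<and>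
     (\<forall>a b a' b'. a \<noteq> b \<longrightarrow> a' \<noteq> b' \<longrightarrow> lev a = lev b \<longrightarrow> lev a' = lev b' \<longrightarrow>
        adj a a' \<longrightarrow> adj b b' \<longrightarrow> (x a b \<longleftrightarrow> x a' b'))"

lemma signing_anti: "signing x \<Longrightarrow> a \<noteq> b \<Longrightarrow> lev a = lev b \<Longrightarrow> x a b \<longleftrightarrow> \<not> x b a"
  unfolding signing_def by blast

lemma signing_step:
  "signing x \<Longrightarrow> a \<noteq> b \<Longrightarrow> a' \<noteq> b' \<Longrightarrow> lev a = lev b \<Longrightarrow> lev a' = lev b' \<Longrightarrow>
    adj a a' \<Longrightarrow> adj b b' \<Longrightarrow> x a b \<longleftrightarrow> x a' b'"
  unfolding signing_def by blast

lemma walk_rev: "successively adj ws \<Longrightarrow> successively adj (rev ws)"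
  by simp (metis (mono_tags, lifting) adj_sym successively_mono)

text \<open>
  The first walk moves from its start to its end on the top level \<open>h\<close>; the second descends at
  least as deep, so that a point on it can accompany the first one and return. The induction splits
  \<open>ws\<close> at its visits to level \<open>h\<close> and \<open>ps\<close> at its last one; the detour of \<open>ps\<close> before that visit is
  treated by the induction hypothesis with the roles of the two walks exchanged.
\<close>

lemma slide:
  assumes x: "signing x"
  shows "successively adj ws \<Longrightarrow> successively adj ps \<Longrightarrow> ws \<noteq> [] \<Longrightarrow> ps \<noteq> [] \<Longrightarrow>
    set ws \<inter> set ps = {} \<Longrightarrow> lev (hd ws) = h \<Longrightarrow> lev (last ws) = h \<Longrightarrow> lev (hd ps) = h \<Longrightarrow>
    \<forall>v\<in>set ws \<union> set ps. lev v \<le> h \<Longrightarrow> \<forall>v\<in>set ws. lev (last ps) \<le> lev v \<Longrightarrow>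
    x (hd ws) (hd ps) \<longleftrightarrow> x (last ws) (hd ps)"
proof (induction "length ws + length ps" arbitrary: ws ps h rule: less_induct)
  case less
  note IH = less.hyps
  note ws = less.prems(1) and ps = less.prems(2) and ne = less.prems(3,4) and disj = less.prems(5)
    and hw = less.prems(6) and lw = less.prems(7) and hp = less.prems(8)
    and top = less.prems(9) and bot = less.prems(10)
  \<comment> \<open>The first three cases are reductions: \<open>ws\<close> is split at an interior
    visit to the top, or \<open>ps\<close> is cut off once it is deep enough. In
    \<open>main\<close>, \<open>ws\<close> touches level \<open>h\<close> only at its ends, and
    \<open>ps\<close> gets as deep as the bottom of \<open>ws\<close> only at its last
    vertex.\<close>
  consider (one) a where "ws = [a]"
    | (inner) w1 c w2 where "ws = w1 @ c # w2" "w1 \<noteq> []" "w2 \<noteq> []" "lev c = h"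
    | (short) p1 c p2 where "ps = p1 @ c # p2" "p2 \<noteq> []" "\<forall>v\<in>set ws. lev c \<le> lev v"
    | (main) "length ws \<ge> 2" "\<And>w1 c w2. ws = w1 @ c # w2 \<Longrightarrow> w1 \<noteq> [] \<Longrightarrow> w2 \<noteq> [] \<Longrightarrow> lev c \<noteq> h"
        "\<And>p1 c p2. ps = p1 @ c # p2 \<Longrightarrow> p2 \<noteq> [] \<Longrightarrow> \<exists>v\<in>set ws. lev v < lev c"
  proof -
    have "ws = [hd ws]" if "\<not> length ws \<ge> 2"
      using that ne by (cases ws; cases "tl ws") auto
    then show ?thesis using that by (metis linorder_not_le)
  qed
  then show ?case
  proof cases
    case one
    then show ?thesis by simp
  next
    case inner
    have s: "successively adj (w1 @ [c])" "successively adj (c # w2)"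
      using ws unfolding inner(1) by (auto simp: successively_append_iff)
    have "x (hd (w1 @ [c])) (hd ps) \<longleftrightarrow> x (last (w1 @ [c])) (hd ps)"
      by (rule IH[where h = h])
        (use s ps ne disj hw hp top bot inner in \<open>auto simp: hd_append\<close>)
    moreover have "x (hd (c # w2)) (hd ps) \<longleftrightarrow> x (last (c # w2)) (hd ps)"
      by (rule IH[where h = h])
        (use s ps ne disj lw hp top bot inner in \<open>auto\<close>)
    ultimately show ?thesis using inner by (auto simp: hd_append)
  next
    case short
    have s: "successively adj (p1 @ [c])"
      using ps unfolding short(1) by (auto simp: successively_append_iff)
    have "x (hd ws) (hd (p1 @ [c])) \<longleftrightarrow> x (last ws) (hd (p1 @ [c]))"
      by (rule IH[where h = h])
        (use s ws ne disj hw lw hp top bot short in \<open>auto simp: hd_append split: if_splits\<close>)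
    moreover have "hd (p1 @ [c]) = hd ps" using short(1) by (cases p1) auto
    ultimately show ?thesis by simp
  next
    case main
    obtain a w where w: "ws = a # w" using ne by (cases ws) auto
    then have "w \<noteq> []" using main(1) by auto
    then obtain mid a' where wsd: "ws = a # mid @ [a']" using w by (metis append_butlast_last_id)
    have la: "lev a = h" "lev a' = h" using hw lw wsd by auto
    have mid: "mid \<noteq> []"
      using ws wsd la adj_lev[of a a'] by auto
    have s1: "successively adj mid" "adj a (hd mid)" "adj (last mid) a'"
      using ws mid unfolding wsd by (auto simp: successively_append_iff successively_Cons)
    have midh: "\<forall>v\<in>set mid. lev v \<le> h - 1"
    proof
      fix v assume v: "v \<in> set mid"
      then obtain m1 m2 where "mid = m1 @ v # m2" by (auto simp: in_set_conv_decomp)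
      then have "lev v \<noteq> h" using main(2)[of "a # m1" v "m2 @ [a']"] wsd by simp
      moreover have "lev v \<le> h" using top v wsd by auto
      ultimately show "lev v \<le> h - 1" by simp
    qed
    have lhm: "lev (hd mid) = h - 1" "lev (last mid) = h - 1"
      using midh mid s1 la adj_lev[of a "hd mid"] adj_lev[of "last mid" a'] hd_in_set[OF mid]
        last_in_set[OF mid] by fastforce+
    define \<mu> where "\<mu> = Min (lev ` set ws)"
    have mu: "\<forall>v\<in>set ws. \<mu> \<le> lev v" unfolding \<mu>_def by simp
    have "\<mu> \<in> lev ` set ws" unfolding \<mu>_def using ne by (intro Min_in) auto
    then obtain m where m: "m \<in> set ws" "lev m = \<mu>" by auto
    then obtain u1 u2 where u: "ws = u1 @ m # u2" by (auto simp: in_set_conv_decomp)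
    have muh: "\<mu> < h" using mu lhm(1) wsd hd_in_set[OF mid] by fastforce
    have su: "successively adj (u1 @ [m])" "successively adj (m # u2)"
      using ws unfolding u by (auto simp: successively_append_iff)
    have "lev (last ps) \<le> \<mu>" using bot m by auto
    obtain p1 q p2 where p: "ps = p1 @ q # p2" "lev q = h" "\<forall>v\<in>set p2. lev v \<noteq> h"
      using split_list_last_prop[of ps "\<lambda>v. lev v = h"] ne hp by (metis hd_in_set)
    have p2: "p2 \<noteq> []"
      using p \<open>lev (last ps) \<le> \<mu>\<close> muh by auto
    have sp: "successively adj (p1 @ [q])" "successively adj p2" "adj q (hd p2)"
      using ps p2 unfolding p(1) by (auto simp: successively_append_iff successively_Cons)
    \<comment> \<open>These vertices come before the end of \<open>ps\<close>, where by
      \<open>main\<close> the bottom level of \<open>ws\<close> is not yet reached.\<close>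
    have above: "\<forall>v\<in>set (p1 @ [q]). \<mu> \<le> lev v"
    proof
      fix v assume "v \<in> set (p1 @ [q])"
      then obtain r1 r2 where r: "p1 @ [q] = r1 @ v # r2" by (meson split_list)
      then have "ps = r1 @ v # (r2 @ p2)" using p(1) by (metis append.assoc append_Cons append_Nil)
      then obtain y where "y \<in> set ws" "lev y < lev v" using main(3) p2 by blast
      then show "\<mu> \<le> lev v" using mu by force
    qed
    have hps: "hd (p1 @ [q]) = hd ps" using p(1) by (cases p1) auto
    have hu: "hd (u1 @ [m]) = a" using u wsd by (cases u1) auto
    have "last ws = last (m # u2)" using u by simp
    then have lu: "last (m # u2) = a'" using wsd by simp
    have lenu: "length (u1 @ [m]) \<le> length ws" "length (m # u2) \<le> length ws" using u by auto
    have lenp: "length (p1 @ [q]) < length ps" "length p2 < length ps" using p p2 by auto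
    \<comment> \<open>Roles exchanged: the first part of \<open>ps\<close> slides from its start to
      its last top vertex \<open>q\<close>, and the part of \<open>ws\<close> down to its lowest
      vertex \<open>m\<close> is the descent.\<close>
    have 1: "x (hd (p1 @ [q])) (hd (u1 @ [m])) \<longleftrightarrow> x (last (p1 @ [q])) (hd (u1 @ [m]))"
    proof (rule IH[where h = h])
      show "length (p1 @ [q]) + length (u1 @ [m]) < length ws + length ps"
        using lenu lenp by linarith
      show "set (p1 @ [q]) \<inter> set (u1 @ [m]) = {}" using disj u p by auto
      show "\<forall>v\<in>set (p1 @ [q]) \<union> set (u1 @ [m]). lev v \<le> h" using top u p by auto
      show "\<forall>v\<in>set (p1 @ [q]). lev (last (u1 @ [m])) \<le> lev v" using above m by simp
    qed (use sp su hps hp p(2) hu la in auto)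
    \<comment> \<open>The same slide against the other end \<open>a'\<close>, whose descent is the
      rest of \<open>ws\<close> read backwards.\<close>
    have 3: "x (hd (p1 @ [q])) (hd (rev (m # u2))) \<longleftrightarrow> x (last (p1 @ [q])) (hd (rev (m # u2)))"
    proof (rule IH[where h = h])
      show "length (p1 @ [q]) + length (rev (m # u2)) < length ws + length ps"
        using lenu lenp by simp
      show "set (p1 @ [q]) \<inter> set (rev (m # u2)) = {}" using disj u p by auto
      show "\<forall>v\<in>set (p1 @ [q]) \<union> set (rev (m # u2)). lev v \<le> h" using top u p by auto
      show "\<forall>v\<in>set (p1 @ [q]). lev (last (rev (m # u2))) \<le> lev v" using above m by simp
      show "successively adj (rev (m # u2))" using su(2) by (rule walk_rev)
      show "lev (hd (rev (m # u2))) = h" using lu la by (simp only: hd_rev)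
    qed (use sp su hps hp p(2) in auto)
    have lp2: "lev (hd p2) = h - 1"
    proof -
      have "hd p2 \<in> set p2" using p2 by simp
      then have "lev (hd p2) \<noteq> h" "lev (hd p2) \<le> h" using p top by auto
      then show ?thesis using adj_lev[OF sp(3)] p(2) by auto
    qed
    \<comment> \<open>A joint step down from \<open>a\<close> and \<open>q\<close> leads to
      \<open>hd mid\<close> and \<open>hd p2\<close>. One level lower, \<open>mid\<close> slides
      against the remaining descent \<open>p2\<close>, and a joint step up then leads to
      \<open>a'\<close> and \<open>q\<close>.\<close>
    have 2: "x (hd mid) (hd p2) \<longleftrightarrow> x (last mid) (hd p2)"
    proof (rule IH[where h = "h - 1"])
      show "length mid + length p2 < length ws + length ps" using wsd p by simp
      show "set mid \<inter> set p2 = {}" using disj wsd p by auto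
      have "lev v \<le> h - 1" if "v \<in> set p2" for v
      proof -
        have "lev v \<le> h" "lev v \<noteq> h" using p top that by auto
        then show ?thesis by simp
      qed
      then show "\<forall>v\<in>set mid \<union> set p2. lev v \<le> h - 1" using midh by auto
      have "last p2 = last ps" using p p2 by simp
      then show "\<forall>v\<in>set mid. lev (last p2) \<le> lev v" using bot wsd by auto
    qed (use s1 sp mid p2 lhm lp2 in auto)
    have "a \<in> set ws" "a' \<in> set ws" "q \<in> set ps" using wsd p(1) by simp_all
    then have d: "a \<noteq> q" "a' \<noteq> q" "a \<noteq> hd ps" "a' \<noteq> hd ps"
      using disj hd_in_set[OF ne(2)] by blast+
    have dd: "hd mid \<noteq> hd p2" "last mid \<noteq> hd p2"
      using disj wsd p hd_in_set[OF p2] hd_in_set[OF mid] last_in_set[OF mid] by auto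
    have "x a (hd ps) \<longleftrightarrow> \<not> x (hd ps) a"
      using signing_anti[OF x, of a "hd ps"] d hp la by auto
    also have "\<dots> \<longleftrightarrow> \<not> x q a" using 1 by (simp only: hps hu last_snoc)
    also have "\<dots> \<longleftrightarrow> x a q" using signing_anti[OF x, of a q] d p(2) la by auto
    also have "\<dots> \<longleftrightarrow> x (hd mid) (hd p2)"
      using signing_step[OF x, of a q "hd mid" "hd p2"] d dd la p(2) lhm lp2 s1 sp by auto
    also have "\<dots> \<longleftrightarrow> x (last mid) (hd p2)" by (rule 2)
    also have "\<dots> \<longleftrightarrow> x a' q"
      using signing_step[OF x, of "last mid" "hd p2" a' q] d dd la p(2) lhm lp2 s1 adj_sym[OF sp(3)] by auto
    also have "\<dots> \<longleftrightarrow> \<not> x q a'" using signing_anti[OF x, of a' q] d p(2) la by auto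
    also have "\<dots> \<longleftrightarrow> \<not> x (hd ps) a'" using 3 lu by (simp only: hps hd_rev last_snoc)
    also have "\<dots> \<longleftrightarrow> x a' (hd ps)" using signing_anti[OF x, of a' "hd ps"] d hp la by auto
    finally show ?thesis using wsd by simp
  qed
qed

text \<open>By \<open>slide\<close>, each walk can be moved to its last visit to the top level, the
  other one serving as descent. From there both step down together, and induction on the height of
  the strip applies. Disjointness keeps the two points distinct.\<close>

lemma cross:
  assumes x: "signing x"
  shows "successively adj ws \<Longrightarrow> successively adj ps \<Longrightarrow> ws \<noteq> [] \<Longrightarrow> ps \<noteq> [] \<Longrightarrow>
    set ws \<inter> set ps = {} \<Longrightarrow> lev (hd ws) = h \<Longrightarrow> lev (last ws) = l \<Longrightarrow>
    lev (hd ps) = h \<Longrightarrow> lev (last ps) = l \<Longrightarrow>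
    \<forall>v\<in>set ws \<union> set ps. l \<le> lev v \<and> lev v \<le> h \<Longrightarrow>
    x (hd ws) (hd ps) \<longleftrightarrow> x (last ws) (last ps)"
proof (induction "nat (h - l)" arbitrary: ws ps h rule: less_induct)
  case less
  note ws = less.prems(1) and ps = less.prems(2) and ne = less.prems(3,4) and disj = less.prems(5)
    and ends = less.prems(6-9) and rng = less.prems(10)
  obtain w1 a w2 where w: "ws = w1 @ a # w2" "lev a = h" "\<forall>v\<in>set w2. lev v \<noteq> h"
    using split_list_last_prop[of ws "\<lambda>v. lev v = h"] ne ends by (metis hd_in_set)
  obtain p1 b p2 where p: "ps = p1 @ b # p2" "lev b = h" "\<forall>v\<in>set p2. lev v \<noteq> h"
    using split_list_last_prop[of ps "\<lambda>v. lev v = h"] ne ends by (metis hd_in_set)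
  have sw: "successively adj (w1 @ [a])" "successively adj (a # w2)"
    using ws unfolding w(1) by (auto simp: successively_append_iff)
  have sp: "successively adj (p1 @ [b])" "successively adj (b # p2)"
    using ps unfolding p(1) by (auto simp: successively_append_iff)
  have hd1: "hd (w1 @ [a]) = hd ws" "hd (p1 @ [b]) = hd ps"
    using w p by (auto simp: hd_append)
  have 1: "x (hd (w1 @ [a])) (hd ps) \<longleftrightarrow> x (last (w1 @ [a])) (hd ps)"
  proof (rule slide[OF x, where h = h])
    show "set (w1 @ [a]) \<inter> set ps = {}" using disj w by auto
    show "\<forall>v\<in>set (w1 @ [a]) \<union> set ps. lev v \<le> h" using rng w by auto
    show "\<forall>v\<in>set (w1 @ [a]). lev (last ps) \<le> lev v" using rng w ends by auto
  qed (use sw ps ne hd1 ends w(2) in auto)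
  have 2: "x (hd (p1 @ [b])) (hd (a # w2)) \<longleftrightarrow> x (last (p1 @ [b])) (hd (a # w2))"
  proof (rule slide[OF x, where h = h])
    show "set (p1 @ [b]) \<inter> set (a # w2) = {}" using disj w p by auto
    show "\<forall>v\<in>set (p1 @ [b]) \<union> set (a # w2). lev v \<le> h" using rng w p by auto
    show "\<forall>v\<in>set (p1 @ [b]). lev (last (a # w2)) \<le> lev v" using rng w p ends by auto
  qed (use sw sp hd1 ends w(2) p(2) in auto)
  have "a \<in> set ws" "b \<in> set ps" using w(1) p(1) by simp_all
  then have d: "a \<noteq> b" "a \<noteq> hd ps" using disj hd_in_set[OF ne(2)] by blast+
  have ab: "x (hd ws) (hd ps) \<longleftrightarrow> x a b"
    using 1 2 signing_anti[OF x, of a b] signing_anti[OF x, of a "hd ps"] d w(2) p(2) ends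
    unfolding hd1 by simp
  show ?case
  proof (cases "h = l")
    case True
    have "w2 = []"
    proof (rule ccontr)
      assume "w2 \<noteq> []"
      then have "hd w2 \<in> set w2" by simp
      then show False using w rng True by force
    qed
    moreover have "p2 = []"
    proof (rule ccontr)
      assume "p2 \<noteq> []"
      then have "hd p2 \<in> set p2" by simp
      then show False using p rng True by force
    qed
    ultimately show ?thesis using ab w p by simp
  next
    case False
    have ne2: "w2 \<noteq> []" "p2 \<noteq> []" using w p ends False by auto
    have adjs: "adj a (hd w2)" "adj b (hd p2)" using sw sp ne2 by (auto simp: successively_Cons)
    have mem: "hd w2 \<in> set w2" "hd p2 \<in> set p2" using ne2 by auto
    have lw: "lev v \<le> h - 1 \<and> l \<le> lev v" if "v \<in> set w2 \<union> set p2" for v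
    proof -
      have "lev v \<le> h" "lev v \<noteq> h" "l \<le> lev v" using that w p rng by auto
      then show ?thesis by simp
    qed
    have lh: "lev (hd w2) = h - 1" "lev (hd p2) = h - 1"
      using lw[of "hd w2"] lw[of "hd p2"] mem adj_lev[OF adjs(1)] adj_lev[OF adjs(2)] w(2) p(2) by auto
    have "hd w2 \<noteq> hd p2" using disj w p mem by auto
    then have "x a b \<longleftrightarrow> x (hd w2) (hd p2)"
      using signing_step[OF x, of a b "hd w2" "hd p2"] d adjs lh w(2) p(2) by simp
    also have "\<dots> \<longleftrightarrow> x (last w2) (last p2)"
    proof (rule less.hyps)
      have "l \<le> h - 1" using lw mem by force
      then show "nat (h - 1 - l) < nat (h - l)" by simp
      show "set w2 \<inter> set p2 = {}" using disj w p by auto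
      show "successively adj w2" "successively adj p2" using sw sp ne2 by (auto simp: successively_Cons)
      show "lev (last w2) = l" "lev (last p2) = l" using ends w p ne2 by auto
    qed (use ne2 lh lw in auto)
    finally show ?thesis using ab w p ne2 by simp
  qed
qed

section \<open>Spanning components\<close>

definition band :: "int \<Rightarrow> int \<Rightarrow> 'v \<Rightarrow> 'v \<Rightarrow> bool" where
  "band l h u v \<longleftrightarrow> adj u v \<and> l \<le> lev u \<and> lev u \<le> h \<and> l \<le> lev v \<and> lev v \<le> h"

definition conn :: "int \<Rightarrow> int \<Rightarrow> 'v \<Rightarrow> 'v \<Rightarrow> bool" where
  "conn l h = (band l h)\<^sup>*\<^sup>*"

lemma conn_refl [simp]: "conn l h a a"
  by (simp add: conn_def)

lemma conn_trans: "conn l h a b \<Longrightarrow> conn l h b c \<Longrightarrow> conn l h a c"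
  by (simp add: conn_def)

lemma conn_sym: "conn l h a b \<Longrightarrow> conn l h b a"
proof -
  have "symp (band l h)" by (auto simp: symp_def band_def adj_sym)
  then show "conn l h a b \<Longrightarrow> conn l h b a"
    unfolding conn_def by (metis sympD symp_rtranclp)
qed

lemma conn_mono: "conn l h a b \<Longrightarrow> l' \<le> l \<Longrightarrow> h \<le> h' \<Longrightarrow> conn l' h' a b"
  unfolding conn_def by (erule rtranclp_mono[THEN predicate2D, rotated]) (auto simp: band_def)

lemma conn_range:
  assumes "conn l h a b" "l \<le> lev a" "lev a \<le> h" shows "l \<le> lev b" "lev b \<le> h"
  using assms unfolding conn_def by (induction rule: rtranclp_induct) (auto simp: band_def)

lemma conn_adj: "adj a b \<Longrightarrow> l \<le> lev a \<Longrightarrow> lev a \<le> h \<Longrightarrow> l \<le> lev b \<Longrightarrow> lev b \<le> h \<Longrightarrow> conn l h a b"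
  unfolding conn_def by (rule r_into_rtranclp) (simp add: band_def)

lemma conn_walk:
  assumes "conn l h a b" "l \<le> lev a" "lev a \<le> h"
  shows "\<exists>ws. ws \<noteq> [] \<and> hd ws = a \<and> last ws = b \<and> successively adj ws \<and>
    (\<forall>v\<in>set ws. conn l h a v \<and> l \<le> lev v \<and> lev v \<le> h)"
  using assms(1) unfolding conn_def
proof (induction rule: rtranclp_induct)
  case base
  show ?case using assms by (intro exI[of _ "[a]"]) auto
next
  case (step b c)
  then obtain ws where ws: "ws \<noteq> []" "hd ws = a" "last ws = b" "successively adj ws"
    "\<forall>v\<in>set ws. (band l h)\<^sup>*\<^sup>* a v \<and> l \<le> lev v \<and> lev v \<le> h" by blast
  moreover have "(band l h)\<^sup>*\<^sup>* a c" using step by auto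
  moreover have "adj b c" "l \<le> lev c" "lev c \<le> h" using step(2) by (auto simp: band_def)
  ultimately show ?case
    by (intro exI[of _ "ws @ [c]"]) (auto simp: successively_append_iff)
qed

lemma walk_conn:
  "successively adj ws \<Longrightarrow> \<forall>v\<in>set ws. l \<le> lev v \<and> lev v \<le> h \<Longrightarrow> v \<in> set ws \<Longrightarrow> conn l h (hd ws) v"
proof (induction ws)
  case (Cons a ws)
  show ?case
  proof (cases "v = a \<or> ws = []")
    case False
    then have "conn l h (hd ws) v" "adj a (hd ws)" "hd ws \<in> set ws"
      using Cons by (auto simp: successively_Cons)
    then show ?thesis using Cons.prems conn_adj[of a "hd ws" l h] conn_trans by auto
  qed (use Cons in auto)
qed simp

definition comp :: "int \<Rightarrow> int \<Rightarrow> 'v \<Rightarrow> 'v set" where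
  "comp l h a = {v. conn l h a v}"

text \<open>A component is named by one of its vertices on the top level; by
  \<open>spans_eq_comp\<close> every other member names the same set.\<close>

definition spans :: "int \<Rightarrow> int \<Rightarrow> 'v set set" where
  "spans l h = {comp l h a | a c. l \<le> h \<and> lev a = h \<and> lev c = l \<and> conn l h a c}"

definition up :: "int \<Rightarrow> 'v set \<Rightarrow> 'v set" where
  "up h K = {z. lev z = h + 1 \<and> (\<exists>k\<in>K. adj k z)}"

definition down :: "int \<Rightarrow> 'v set \<Rightarrow> 'v set" where
  "down l K = {z. lev z = l - 1 \<and> (\<exists>k\<in>K. adj k z)}"

lemma comp_eq: "b \<in> comp l h a \<Longrightarrow> comp l h b = comp l h a"
  unfolding comp_def using conn_trans conn_sym by blast

lemma spans_eq_comp: "K \<in> spans l h \<Longrightarrow> a \<in> K \<Longrightarrow> K = comp l h a"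
  unfolding spans_def using comp_eq by blast

lemma spans_conn: "K \<in> spans l h \<Longrightarrow> a \<in> K \<Longrightarrow> b \<in> K \<longleftrightarrow> conn l h a b"
  using spans_eq_comp[of K l h a] unfolding comp_def by auto

lemma spans_lev:
  assumes "K \<in> spans l h" "v \<in> K" shows "l \<le> lev v" "lev v \<le> h"
  using assms conn_range[of l h] unfolding spans_def comp_def by fastforce+

lemma spans_le: "K \<in> spans l h \<Longrightarrow> l \<le> h"
  unfolding spans_def by auto

lemma spans_top: assumes "K \<in> spans l h" obtains a where "a \<in> K" "lev a = h"
  using assms conn_refl unfolding spans_def comp_def by blast

lemma spans_bot: assumes "K \<in> spans l h" obtains a where "a \<in> K" "lev a = l"
  using assms unfolding spans_def comp_def by blast

lemma spans_disjoint: "K \<in> spans l h \<Longrightarrow> L \<in> spans l h \<Longrightarrow> K \<noteq> L \<Longrightarrow> a \<in> K \<Longrightarrow> a \<notin> L"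
  using spans_eq_comp by blast

lemma spansI: "l \<le> h \<Longrightarrow> lev a = h \<Longrightarrow> lev c = l \<Longrightarrow> conn l h a c \<Longrightarrow> comp l h a \<in> spans l h"
  unfolding spans_def by blast

lemma spans_walk:
  assumes "K \<in> spans l h" "a \<in> K" "b \<in> K"
  obtains ws where "ws \<noteq> []" "hd ws = a" "last ws = b" "successively adj ws" "set ws \<subseteq> K"
  using conn_walk[of l h a b] spans_conn[OF assms(1,2)] spans_lev[OF assms(1,2)] assms(3) that
  by (metis subsetI)

lemma up_lev:
  assumes "K \<in> spans l h" "z \<in> up h K" obtains k where "k \<in> K" "adj k z" "lev k = h" "lev z = h + 1"
  using assms spans_lev[OF assms(1)] adj_lev unfolding up_def by fastforce

lemma down_lev:
  assumes "K \<in> spans l h" "z \<in> down l K" obtains k where "k \<in> K" "adj k z" "lev k = l" "lev z = l - 1"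
  using assms spans_lev[OF assms(1)] adj_lev unfolding down_def by fastforce

text \<open>An empty exit set blocks its side vacuously; if both exit sets on a side are nonempty,
  the condition makes them the same singleton. Either way, two points on a common level cannot leave
  the components together towards distinct points.\<close>

definition blocked :: "int \<Rightarrow> int \<Rightarrow> 'v set \<Rightarrow> 'v set \<Rightarrow> bool" where
  "blocked l h K L \<longleftrightarrow>
     (\<forall>z z'. z \<in> up h K \<longrightarrow> z' \<in> up h L \<longrightarrow> z = z') \<and>
     (\<forall>z z'. z \<in> down l K \<longrightarrow> z' \<in> down l L \<longrightarrow> z = z')"

end

section \<open>Comparison of spanning components\<close>

locale signed_level_graph = level_graph +
  fixes x :: "'a \<Rightarrow> 'a \<Rightarrow> bool"
  assumes x: "signing x"
begin

definition below :: "int \<Rightarrow> 'a set \<Rightarrow> 'a set \<Rightarrow> bool" where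
  "below h K L \<longleftrightarrow> (\<exists>a\<in>K. \<exists>b\<in>L. lev a = h \<and> lev b = h \<and> x a b)"

text \<open>\<open>slide\<close> applies because distinct components are disjoint and
  \<open>L\<close> reaches level \<open>l\<close>, which gives a descent as deep as any point of
  \<open>K\<close>.\<close>

lemma slide_spans:
  assumes K: "K \<in> spans l h" and L: "L \<in> spans l h" and "K \<noteq> L"
    and a: "a \<in> K" "a' \<in> K" "lev a = h" "lev a' = h" and b: "b \<in> L" "lev b = h"
  shows "x a b \<longleftrightarrow> x a' b"
proof -
  obtain ws where ws: "ws \<noteq> []" "hd ws = a" "last ws = a'" "successively adj ws" "set ws \<subseteq> K"
    using spans_walk[OF K a(1,2)] .
  obtain c where c: "c \<in> L" "lev c = l" using spans_bot[OF L] .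
  obtain ps where ps: "ps \<noteq> []" "hd ps = b" "last ps = c" "successively adj ps" "set ps \<subseteq> L"
    using spans_walk[OF L b(1) c(1)] .
  have "x (hd ws) (hd ps) \<longleftrightarrow> x (last ws) (hd ps)"
  proof (rule slide[OF x, where h = h])
    show "set ws \<inter> set ps = {}" using ws ps spans_disjoint[OF K L \<open>K \<noteq> L\<close>] by blast
    show "\<forall>v\<in>set ws \<union> set ps. lev v \<le> h"
      using ws(5) ps(5) spans_lev(2)[OF K] spans_lev(2)[OF L] by blast
    show "\<forall>v\<in>set ws. lev (last ps) \<le> lev v" using ws(5) ps c spans_lev(1)[OF K] by auto
  qed (use ws ps a b in auto)
  then show ?thesis using ws ps by simp
qed

text \<open>Independence of representatives: sliding in each component in turn shows that all pairs
  of top vertices agree, so the existential definition of \<open>below\<close> may be tested at any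
  of them.\<close>

lemma below_top:
  assumes K: "K \<in> spans l h" and L: "L \<in> spans l h" and "K \<noteq> L"
    and a: "a \<in> K" "lev a = h" and b: "b \<in> L" "lev b = h"
  shows "x a b \<longleftrightarrow> below h K L"
proof -
  have "x a b \<longleftrightarrow> x a' b'" if "a' \<in> K" "b' \<in> L" "lev a' = h" "lev b' = h" for a' b'
  proof -
    have ne: "a' \<noteq> b" "a' \<noteq> b'" using spans_disjoint[OF K L \<open>K \<noteq> L\<close>] that b by blast+
    have "x a b \<longleftrightarrow> x a' b" using slide_spans[OF K L \<open>K \<noteq> L\<close>] a b that by blast
    also have "\<dots> \<longleftrightarrow> \<not> x b a'" using signing_anti[OF x ne(1)] that b by simp
    also have "\<dots> \<longleftrightarrow> \<not> x b' a'" using slide_spans[OF L K] \<open>K \<noteq> L\<close> b that by blast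
    also have "\<dots> \<longleftrightarrow> x a' b'" using signing_anti[OF x ne(2)] that by simp
    finally show ?thesis .
  qed
  then show ?thesis unfolding below_def using a b by blast
qed

text \<open>\<open>cross\<close>, applied to descents in the two components, carries the comparison
  from top to bottom. This makes \<open>below\<close> compatible with reversing the levels.\<close>

lemma below_bot:
  assumes K: "K \<in> spans l h" and L: "L \<in> spans l h" and "K \<noteq> L"
    and c: "c \<in> K" "lev c = l" and d: "d \<in> L" "lev d = l"
  shows "x c d \<longleftrightarrow> below h K L"
proof -
  obtain a where a: "a \<in> K" "lev a = h" using spans_top[OF K] .
  obtain b where b: "b \<in> L" "lev b = h" using spans_top[OF L] .
  obtain ws where ws: "ws \<noteq> []" "hd ws = a" "last ws = c" "successively adj ws" "set ws \<subseteq> K"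
    using spans_walk[OF K a(1) c(1)] .
  obtain ps where ps: "ps \<noteq> []" "hd ps = b" "last ps = d" "successively adj ps" "set ps \<subseteq> L"
    using spans_walk[OF L b(1) d(1)] .
  have "x (hd ws) (hd ps) \<longleftrightarrow> x (last ws) (last ps)"
  proof (rule cross[OF x, where h = h and l = l])
    show "set ws \<inter> set ps = {}" using ws ps spans_disjoint[OF K L \<open>K \<noteq> L\<close>] by blast
    show "\<forall>v\<in>set ws \<union> set ps. l \<le> lev v \<and> lev v \<le> h"
      using ws(5) ps(5) spans_lev[OF K] spans_lev[OF L] by blast
  qed (use ws ps a b c d in auto)
  then show ?thesis using ws ps below_top[OF K L \<open>K \<noteq> L\<close> a b] by simp
qed

lemma below_anti:
  assumes K: "K \<in> spans l h" and L: "L \<in> spans l h" and "K \<noteq> L"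
  shows "below h K L \<longleftrightarrow> \<not> below h L K"
proof -
  obtain a where a: "a \<in> K" "lev a = h" using spans_top[OF K] .
  obtain b where b: "b \<in> L" "lev b = h" using spans_top[OF L] .
  have "a \<noteq> b" using spans_disjoint[OF K L \<open>K \<noteq> L\<close>] a b by blast
  then have "x a b \<longleftrightarrow> \<not> x b a" using signing_anti[OF x, of a b] a b by simp
  then show ?thesis
    using below_top[OF K L \<open>K \<noteq> L\<close> a b] below_top[OF L K \<open>K \<noteq> L\<close>[symmetric] b a] by blast
qed

lemma below_up:
  assumes K: "K \<in> spans l h" and L: "L \<in> spans l h" and "K \<noteq> L"
    and z: "z \<in> up h K" "z' \<in> up h L" "z \<noteq> z'"
  shows "x z z' \<longleftrightarrow> below h K L"
proof -
  obtain k where k: "k \<in> K" "adj k z" "lev k = h" "lev z = h + 1" using up_lev[OF K z(1)] .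
  obtain k' where k': "k' \<in> L" "adj k' z'" "lev k' = h" "lev z' = h + 1" using up_lev[OF L z(2)] .
  have "k \<noteq> k'" using spans_disjoint[OF K L \<open>K \<noteq> L\<close>] k k' by blast
  then have "x k k' \<longleftrightarrow> x z z'" using signing_step[OF x, of k k' z z'] k k' z(3) by simp
  then show ?thesis using below_top[OF K L \<open>K \<noteq> L\<close>] k k' by blast
qed

lemma below_down:
  assumes K: "K \<in> spans l h" and L: "L \<in> spans l h" and "K \<noteq> L"
    and z: "z \<in> down l K" "z' \<in> down l L" "z \<noteq> z'"
  shows "x z z' \<longleftrightarrow> below h K L"
proof -
  obtain k where k: "k \<in> K" "adj k z" "lev k = l" "lev z = l - 1" using down_lev[OF K z(1)] .
  obtain k' where k': "k' \<in> L" "adj k' z'" "lev k' = l" "lev z' = l - 1" using down_lev[OF L z(2)] .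
  have "k \<noteq> k'" using spans_disjoint[OF K L \<open>K \<noteq> L\<close>] k k' by blast
  then have "x k k' \<longleftrightarrow> x z z'" using signing_step[OF x, of k k' z z'] k k' z(3) by simp
  then show ?thesis using below_bot[OF K L \<open>K \<noteq> L\<close>] k k' by blast
qed

section \<open>Three-cycles of spanning components\<close>

definition cyclic :: "int \<Rightarrow> int \<Rightarrow> 'a set \<Rightarrow> 'a set \<Rightarrow> 'a set \<Rightarrow> bool" where
  "cyclic l h K L M \<longleftrightarrow> K \<in> spans l h \<and> L \<in> spans l h \<and> M \<in> spans l h \<and>
     K \<noteq> L \<and> L \<noteq> M \<and> M \<noteq> K \<and> below h K L \<and> below h L M \<and> below h M K"

definition consistent :: "int \<Rightarrow> int \<Rightarrow> bool" where
  "consistent l h \<longleftrightarrow> (\<nexists>K L M. cyclic l h K L M)"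

text \<open>A walk from \<open>K\<close> to \<open>L\<close> must reach level \<open>h + 1\<close>;
  its first and last vertices there are exits of \<open>K\<close> and of \<open>L\<close>. The exit
  \<open>z\<close> followed by a descent through \<open>M\<close> is a second walk disjoint from it,
  so \<open>slide\<close> on level \<open>h + 1\<close> shows that both exits compare with
  \<open>z\<close> in the same way.\<close>

lemma detour:
  assumes K: "K \<in> spans l h" and L: "L \<in> spans l h" and M: "M \<in> spans l h"
    and neq: "K \<noteq> L" "L \<noteq> M" "M \<noteq> K"
    and ws: "ws \<noteq> []" "successively adj ws" "\<forall>v\<in>set ws. l \<le> lev v \<and> lev v \<le> h + 1"
      "hd ws \<in> K" "last ws \<in> L" "set ws \<inter> M = {}"
    and z: "z \<in> up h M" "z \<notin> set ws"
  shows "below h K M \<longleftrightarrow> below h L M"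
proof -
  have "\<exists>v\<in>set ws. lev v = h + 1"
  proof (rule ccontr)
    assume "\<not> ?thesis"
    then have "\<forall>v\<in>set ws. l \<le> lev v \<and> lev v \<le> h" using ws(3) by force
    then have "conn l h (hd ws) (last ws)" using walk_conn[OF ws(2)] ws(1) by auto
    then have "last ws \<in> K" using spans_conn[OF K ws(4)] by simp
    then show False using spans_disjoint[OF K L neq(1)] ws(5) by blast
  qed
  then obtain u1 y u2 where u: "ws = u1 @ y # u2" "lev y = h + 1" "\<forall>v\<in>set u1. lev v \<noteq> h + 1"
    using split_list_first_prop[of ws "\<lambda>v. lev v = h + 1"] by blast
  then have "\<exists>v\<in>set (y # u2). lev v = h + 1" by auto
  then obtain v1 y' v2 where v: "y # u2 = v1 @ y' # v2" "lev y' = h + 1" "\<forall>v\<in>set v2. lev v \<noteq> h + 1"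
    using split_list_last_prop[of "y # u2" "\<lambda>v. lev v = h + 1"] by blast
  have wsv: "ws = u1 @ v1 @ y' # v2" using u(1) v(1) by simp
  have u1: "u1 \<noteq> []" using u ws(4) spans_lev(2)[OF K ws(4)] by (cases u1) auto
  have v2: "v2 \<noteq> []" using wsv v(2) ws(5) spans_lev(2)[OF L ws(5)] by auto
  have s: "successively adj u1" "adj (last u1) y" "successively adj (v1 @ [y'])" "successively adj v2"
    "adj y' (hd v2)"
    using ws(2) u1 v2 by (auto simp: wsv successively_append_iff successively_Cons)
      (use ws(2) u1 in \<open>auto simp: u(1) successively_append_iff successively_Cons\<close>)
  have lu1: "\<forall>v\<in>set u1. l \<le> lev v \<and> lev v \<le> h" using u(3) ws(3) wsv by force
  have lv2: "\<forall>v\<in>set v2. l \<le> lev v \<and> lev v \<le> h" using v(3) ws(3) wsv by force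
  have k: "last u1 \<in> K"
    using walk_conn[OF s(1) lu1, of "last u1"] u1 spans_conn[OF K ws(4)] u(1) by simp
  have k': "hd v2 \<in> L"
    using walk_conn[OF s(4) lv2, of "last v2"] v2 spans_conn[OF L ws(5)] wsv conn_sym by simp
  have yK: "y \<in> up h K" using k s(2) u(2) unfolding up_def by blast
  have yL: "y' \<in> up h L" using k' adj_sym[OF s(5)] v(2) unfolding up_def by blast
  obtain m where m: "m \<in> M" "adj m z" "lev m = h" "lev z = h + 1" using up_lev[OF M z(1)] .
  obtain c where c: "c \<in> M" "lev c = l" using spans_bot[OF M] .
  obtain ps where ps: "ps \<noteq> []" "hd ps = m" "last ps = c" "successively adj ps" "set ps \<subseteq> M"
    using spans_walk[OF M m(1) c(1)] .
  have hv: "hd (v1 @ [y']) = y" using v(1) by (cases v1) auto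
  have "x (hd (v1 @ [y'])) (hd (z # ps)) \<longleftrightarrow> x (last (v1 @ [y'])) (hd (z # ps))"
  proof (rule slide[OF x, where h = "h + 1"])
    show "set (v1 @ [y']) \<inter> set (z # ps) = {}" using ws(6) ps(5) z(2) wsv by auto
    show "\<forall>v\<in>set (v1 @ [y']) \<union> set (z # ps). lev v \<le> h + 1"
    proof
      fix v assume "v \<in> set (v1 @ [y']) \<union> set (z # ps)"
      then have "v \<in> set ws \<or> v = z \<or> v \<in> M" using wsv ps(5) by auto
      then show "lev v \<le> h + 1" using ws(3) m(4) spans_lev(2)[OF M] by fastforce
    qed
    show "\<forall>v\<in>set (v1 @ [y']). lev (last (z # ps)) \<le> lev v" using ws(3) wsv ps c by auto
    show "successively adj (z # ps)" using ps m(2) adj_sym by (simp add: successively_Cons)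
    show "lev (hd (v1 @ [y'])) = h + 1" using hv u(2) by simp
  qed (use s v m in auto)
  then have "x y z \<longleftrightarrow> x y' z" by (simp only: hv last_snoc list.sel)
  moreover have "z \<noteq> y" "z \<noteq> y'" using z(2) u(1) arg_cong[OF wsv, of set] by auto
  ultimately show ?thesis
    using below_up[OF K M _ yK z(1)] below_up[OF L M _ yL z(1)] neq by auto
qed

text \<open>
  If all three components have exits above, then either the 3-cycle persists in \<open>[l, h + 1]\<close>, or two of
  the components can be joined there. A shortest such connecting walk has a single vertex \<open>z\<close> on
  level \<open>h + 1\<close>, since otherwise the third component could let a point pass along the walk (\<open>detour\<close>).
\<close>

lemma cyclic_up:
  assumes cyc: "cyclic l h K L M" and cons: "consistent l (h + 1)"
    and ne: "up h K \<noteq> {}" "up h L \<noteq> {}" "up h M \<noteq> {}"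
  shows "\<exists>z. up h K = {z} \<and> up h L = {z} \<and> up h M = {z}"
proof -
  let ?S = "{K, L, M}"
  have S: "A \<in> spans l h" "up h A \<noteq> {}" if "A \<in> ?S" for A
    using that cyc ne unfolding cyclic_def by auto
  \<comment> \<open>In a 3-cycle the other two members lie on opposite sides of each member, which
    is what \<open>detour\<close> contradicts.\<close>
  have differ: "below h A C \<noteq> below h B C"
    if "A \<in> ?S" "B \<in> ?S" "C \<in> ?S" "A \<noteq> B" "B \<noteq> C" "C \<noteq> A" for A B C
    using that cyc below_anti[of K l h L] below_anti[of L l h M] below_anti[of M l h K]
    unfolding cyclic_def by (elim insertE emptyE) auto
  define P where "P ws \<longleftrightarrow> ws \<noteq> [] \<and> successively adj ws \<and>
    (\<forall>v\<in>set ws. l \<le> lev v \<and> lev v \<le> h + 1) \<and>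
    (\<exists>A\<in>?S. \<exists>B\<in>?S. A \<noteq> B \<and> hd ws \<in> A \<and> last ws \<in> B)" for ws
  have "\<exists>ws. P ws"
  proof (rule ccontr)
    assume none: "\<nexists>ws. P ws"
    \<comment> \<open>\<open>C A\<close> is the component over the longer interval through a chosen
      exit \<open>e A\<close>. Without a connecting walk the three are distinct, and they inherit
      the cyclic order from their exits.\<close>
    define C where "C A = comp l (h + 1) (SOME z. z \<in> up h A)" for A
    define e where "e A = (SOME z. z \<in> up h A)" for A
    have e: "e A \<in> up h A" if "A \<in> ?S" for A
      using S(2)[OF that] unfolding e_def by (simp add: some_in_eq)
    have link: "\<exists>k\<in>A. conn l (h + 1) (e A) k \<and> l \<le> lev k \<and> lev k \<le> h + 1" if A: "A \<in> ?S" for A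
    proof -
      obtain k where k: "k \<in> A" "adj k (e A)" "lev k = h" "lev (e A) = h + 1"
        using up_lev[OF S(1)[OF A] e[OF A]] .
      then show ?thesis using conn_adj[OF adj_sym[OF k(2)], of l "h + 1"] spans_le[OF S(1)[OF A]] by auto
    qed
    have Cs: "C A \<in> spans l (h + 1)" if A: "A \<in> ?S" for A
    proof -
      obtain k where k: "k \<in> A" "conn l (h + 1) (e A) k" using link[OF A] by blast
      obtain c where c: "c \<in> A" "lev c = l" using spans_bot[OF S(1)[OF A]] .
      have "conn l h k c" using spans_conn[OF S(1)[OF A] k(1)] c by simp
      then have "conn l (h + 1) (e A) c" using k(2) conn_mono[of l h k c l "h + 1"] conn_trans by simp
      moreover have "lev (e A) = h + 1" using e[OF A] unfolding up_def by simp
      ultimately show ?thesis unfolding C_def e_def[symmetric]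
        using spansI[of l "h + 1" "e A" c] c spans_le[OF S(1)[OF A]] by simp
    qed
    have eC: "e A \<in> C A" for A unfolding C_def e_def comp_def by simp
    have neq: "C A \<noteq> C B" if A: "A \<in> ?S" and B: "B \<in> ?S" and "A \<noteq> B" for A B
    proof
      assume "C A = C B"
      then have "e B \<in> C A" using eC by blast
      then have AB: "conn l (h + 1) (e A) (e B)" unfolding C_def e_def comp_def by simp
      obtain a where a: "a \<in> A" "conn l (h + 1) (e A) a" "l \<le> lev a" "lev a \<le> h + 1" using link[OF A] by blast
      obtain b where b: "b \<in> B" "conn l (h + 1) (e B) b" using link[OF B] by blast
      have "conn l (h + 1) a b" using a b AB conn_sym conn_trans by meson
      from conn_walk[OF this a(3,4)] obtain ws where "ws \<noteq> []" "hd ws = a" "last ws = b"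
        "successively adj ws" "\<forall>v\<in>set ws. conn l (h + 1) a v \<and> l \<le> lev v \<and> lev v \<le> h + 1" by blast
      then have "P ws" unfolding P_def using A B \<open>A \<noteq> B\<close> a(1) b(1) by blast
      then show False using none by blast
    qed
    have bel: "below (h + 1) (C A) (C B)" if A: "A \<in> ?S" and B: "B \<in> ?S" and "A \<noteq> B" "below h A B" for A B
    proof -
      have "e A \<noteq> e B"
        using neq[OF A B \<open>A \<noteq> B\<close>] eC spans_disjoint[OF Cs[OF A] Cs[OF B]] by metis
      then have "x (e A) (e B)" using below_up[OF S(1)[OF A] S(1)[OF B] \<open>A \<noteq> B\<close>] e A B that by blast
      moreover have "lev (e A) = h + 1" "lev (e B) = h + 1" using e A B unfolding up_def by auto
      ultimately show ?thesis unfolding below_def using eC by blast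
    qed
    have "cyclic l (h + 1) (C K) (C L) (C M)"
      unfolding cyclic_def using Cs neq bel cyc[unfolded cyclic_def] by auto
    then show False using cons unfolding consistent_def by blast
  qed
  then obtain ws where ws: "P ws" and least: "\<And>vs. P vs \<Longrightarrow> length ws \<le> length vs"
    using ex_has_least_nat[of P _ length] by blast
  then obtain A B where A: "A \<in> ?S" and B: "B \<in> ?S" and AB: "A \<noteq> B" "hd ws \<in> A" "last ws \<in> B"
    unfolding P_def by blast
  have "K \<noteq> L" "L \<noteq> M" "M \<noteq> K" using cyc unfolding cyclic_def by auto
  then obtain C where C: "C \<in> ?S" "B \<noteq> C" "C \<noteq> A" and ABC: "{A, B, C} = ?S"
    using A B AB(1) by (elim insertE emptyE) auto
  have wsP: "ws \<noteq> []" "successively adj ws" "\<forall>v\<in>set ws. l \<le> lev v \<and> lev v \<le> h + 1"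
    using ws unfolding P_def by auto
  \<comment> \<open>Stopping at a visit to \<open>C\<close> would give a shorter connecting walk,
    from \<open>A\<close> to \<open>C\<close>. The last vertex is no such visit, as it lies in
    \<open>B\<close>.\<close>
  have disj: "set ws \<inter> C = {}"
  proof (rule ccontr)
    assume "set ws \<inter> C \<noteq> {}"
    then obtain c u v where c: "c \<in> C" "ws = u @ c # v" by (metis disjoint_iff in_set_conv_decomp)
    have "P (u @ [c])"
      unfolding P_def
    proof (intro conjI)
      show "successively adj (u @ [c])" using wsP(2) c(2) by (auto simp: successively_append_iff)
      show "\<forall>w\<in>set (u @ [c]). l \<le> lev w \<and> lev w \<le> h + 1" using wsP(3) c(2) by auto
      have "hd (u @ [c]) \<in> A" using AB(2) c(2) by (cases u) auto
      then show "\<exists>A\<in>?S. \<exists>B\<in>?S. A \<noteq> B \<and> hd (u @ [c]) \<in> A \<and> last (u @ [c]) \<in> B"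
        using A C c(1) by fastforce
    qed simp
    then have "v = []" using least c(2) by fastforce
    then show False using spans_disjoint[OF S(1)[OF B] S(1)[OF C(1)] C(2)] AB(3) c by auto
  qed
  have upC: "up h C \<subseteq> set ws"
    using detour[OF S(1)[OF A] S(1)[OF B] S(1)[OF C(1)] AB(1) C(2,3) wsP AB(2,3) disj]
      differ[OF A B C(1) AB(1) C(2,3)] by blast
  obtain z where z: "z \<in> up h C" using S(2)[OF C(1)] by blast
  then obtain k where k: "k \<in> C" "adj k z" "lev k = h" "lev z = h + 1" using up_lev[OF S(1)[OF C(1)]] by metis
  have lev_S: "lev w \<noteq> h + 1" if "D \<in> ?S" "w \<in> D" for D w using spans_lev(2)[OF S(1)[OF that(1)] that(2)] by simp
  have "l \<le> h" using spans_le[OF S(1)[OF A]] .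
  obtain u v where uv: "ws = u @ z # v" using upC z by (meson split_list subsetD)
  have une: "u \<noteq> []" using AB(2) uv lev_S[OF A] k(4) by (cases u) auto
  have vne: "v \<noteq> []" using AB(3) uv lev_S[OF B] k(4) by (cases v) auto
  \<comment> \<open>Turning off at \<open>z\<close> to its neighbour \<open>k\<close> in
    \<open>C\<close> is again a connecting walk, so minimality leaves at most one vertex after
    \<open>z\<close>; the mirrored walk below does the same for the vertices before
    \<open>z\<close>.\<close>
  have "P (u @ [z, k])"
    unfolding P_def
  proof (intro conjI)
    show "successively adj (u @ [z, k])"
      using wsP(2) uv adj_sym[OF k(2)] by (auto simp: successively_append_iff)
    show "\<forall>w\<in>set (u @ [z, k]). l \<le> lev w \<and> lev w \<le> h + 1" using wsP(3) uv k \<open>l \<le> h\<close> by auto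
    have "hd (u @ [z, k]) \<in> A" using AB(2) uv une by simp
    then show "\<exists>A\<in>?S. \<exists>B\<in>?S. A \<noteq> B \<and> hd (u @ [z, k]) \<in> A \<and> last (u @ [z, k]) \<in> B"
      using A C k(1) by fastforce
  qed simp
  from least[OF this] have lv: "length v \<le> 1" using uv by simp
  have "P (k # z # v)"
    unfolding P_def
  proof (intro conjI)
    show "successively adj (k # z # v)"
      using wsP(2) uv k(2) by (auto simp: successively_append_iff)
    show "\<forall>w\<in>set (k # z # v). l \<le> lev w \<and> lev w \<le> h + 1" using wsP(3) uv k \<open>l \<le> h\<close> by auto
    have "last (k # z # v) \<in> B" using AB(3) uv vne by simp
    then show "\<exists>A\<in>?S. \<exists>B\<in>?S. A \<noteq> B \<and> hd (k # z # v) \<in> A \<and> last (k # z # v) \<in> B"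
      using B C k(1) by fastforce
  qed simp
  from least[OF this] have lu: "length u \<le> 1" using uv by simp
  obtain a b where "u = [a]" "v = [b]"
    using lu lv une vne by (cases u; cases v) auto
  then have wsz: "ws = [a, z, b]" using uv by simp
  have ab: "a \<in> A" "b \<in> B" "adj a z" "adj b z" using AB wsz wsP(2) adj_sym by auto
  have C': "up h C = {z}"
  proof -
    have "w = z" if "w \<in> up h C" for w
    proof -
      have "w \<in> {a, z, b}" "lev w = h + 1" using that upC wsz unfolding up_def by auto
      then show ?thesis using lev_S[OF A ab(1)] lev_S[OF B ab(2)] by auto
    qed
    then show ?thesis using z by blast
  qed
  \<comment> \<open>The walk from \<open>E\<close> over \<open>z\<close> to \<open>C\<close> avoids
    \<open>D\<close>; a second exit \<open>w\<close> of \<open>D\<close> would let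
    \<open>detour\<close> put \<open>E\<close> and \<open>C\<close> on the same side of
    \<open>D\<close>.\<close>
  have single: "up h D = {z}"
    if D: "D \<in> ?S" "E \<in> ?S" "D \<noteq> E" "E \<noteq> C" "C \<noteq> D" "d \<in> D" "e \<in> E" "adj d z" "adj e z" for D E d e
  proof -
    have le: "l \<le> lev e" "lev e \<le> h" using spans_lev[OF S(1)[OF D(2)] D(7)] by auto
    have "w = z" if w: "w \<in> up h D" for w
    proof (rule ccontr)
      assume "w \<noteq> z"
      have lw: "lev w = h + 1" using w unfolding up_def by simp
      have "below h E D \<longleftrightarrow> below h C D"
      proof (rule detour[OF S(1)[OF D(2)] S(1)[OF C(1)] S(1)[OF D(1)], where ws = "[e, z, k]" and z = w])
        have "z \<notin> D" using lev_S[OF D(1)] k(4) by blast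
        then show "set [e, z, k] \<inter> D = {}"
          using spans_disjoint[OF S(1)[OF D(2)] S(1)[OF D(1)]] spans_disjoint[OF S(1)[OF C(1)] S(1)[OF D(1)]] D k
          by auto
        show "w \<notin> set [e, z, k]" using \<open>w \<noteq> z\<close> lw k le by auto
      qed (use D k w adj_sym le \<open>l \<le> h\<close> in auto)
      then show False using differ[OF D(2) C(1) D(1)] D by blast
    qed
    moreover have "z \<in> up h D" unfolding up_def using D k(4) by blast
    ultimately show ?thesis by blast
  qed
  have "up h A = {z}" "up h B = {z}"
    using single[OF A B AB(1) C(2,3) ab] single[OF B A _ _ _ ab(2,1,4,3)] AB(1) C by auto
  then have "\<forall>D\<in>?S. up h D = {z}" using C' ABC by (metis empty_iff insert_iff)
  then show ?thesis by blast
qed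

end

section \<open>Reversal of levels and exits from components\<close>

context level_graph
begin

text \<open>Negating the levels exchanges up and down, so every statement about upper exits yields
  its mirror image for lower ones.\<close>

lemma level_graph_dual: "level_graph adj (\<lambda>v. - lev v)"
  by unfold_locales (use adj_sym adj_lev in fastforce)+

interpretation dual: level_graph adj "\<lambda>v. - lev v"
  by (rule level_graph_dual)

lemma conn_dual: "dual.conn (- h) (- l) = conn l h"
proof -
  have "dual.band (- h) (- l) = band l h"
    by (auto simp: fun_eq_iff dual.band_def band_def)
  then show ?thesis by (simp add: dual.conn_def conn_def)
qed

lemma comp_dual: "dual.comp (- h) (- l) = comp l h"
  by (simp add: fun_eq_iff dual.comp_def comp_def conn_dual)

lemma spans_dual: "dual.spans (- h) (- l) = spans l h"
proof -
  have "comp l h a \<in> spans l h \<longleftrightarrow> comp l h a \<in> dual.spans (- h) (- l)" if "l \<le> lev a" "lev a \<le> h" for a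
    using that unfolding spans_def dual.spans_def comp_dual conn_dual
    by (auto; metis comp_def comp_eq conn_sym mem_Collect_eq)
  moreover have "\<exists>a. K = comp l h a \<and> l \<le> lev a \<and> lev a \<le> h" if "K \<in> spans l h" for K
    using that unfolding spans_def by auto
  moreover have "\<exists>a. K = comp l h a \<and> l \<le> lev a \<and> lev a \<le> h" if "K \<in> dual.spans (- h) (- l)" for K
    using that unfolding dual.spans_def comp_dual by auto
  ultimately show ?thesis by blast
qed

lemma up_dual: "dual.up (- l) K = down l K"
  by (auto simp: dual.up_def down_def)

lemma signing_dual: "dual.signing x = signing x"
  by (simp add: dual.signing_def signing_def)

text \<open>A walk inside \<open>K'\<close> from \<open>a\<close> to the higher top level stays in
  \<open>K\<close> until it first rises above \<open>h\<close>: it cannot drop under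
  \<open>l\<close>, as \<open>K'\<close> lies at or above \<open>l'\<close>. The vertex reached then
  is an exit.\<close>

lemma escape_up:
  assumes K: "K \<in> spans l h" "a \<in> K" and K': "K' \<in> spans l' h'" "a \<in> K'" and "l \<le> l'" "h < h'"
  shows "\<exists>z\<in>up h K. z \<in> K'"
proof -
  obtain c where c: "c \<in> K'" "lev c = h'" using spans_top[OF K'(1)] .
  obtain ws where ws: "ws \<noteq> []" "hd ws = a" "last ws = c" "successively adj ws" "set ws \<subseteq> K'"
    using spans_walk[OF K' c(1)] .
  have "\<exists>v\<in>set ws. lev v > h" using ws(1,3) c(2) assms(6) last_in_set by metis
  then obtain u z v where u: "ws = u @ z # v" "lev z > h" "\<forall>y\<in>set u. \<not> lev y > h"
    using split_list_first_prop[of ws "\<lambda>v. lev v > h"] by blast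
  have "u \<noteq> []" using u ws(2) spans_lev(2)[OF K] by (cases u) auto
  then have s: "successively adj u" "adj (last u) z" "hd u = a"
    using ws(2,4) u(1) by (auto simp: successively_append_iff)
  have "\<forall>y\<in>set u. l \<le> lev y \<and> lev y \<le> h"
  proof
    fix y assume y: "y \<in> set u"
    then have "y \<in> K'" using ws(5) u(1) by auto
    then show "l \<le> lev y \<and> lev y \<le> h" using spans_lev(1)[OF K'(1)] assms(5) u(3) y by force
  qed
  then have lu: "conn l h a (last u)" "lev (last u) \<le> h"
    using walk_conn[OF s(1), of l h "last u"] s(3) \<open>u \<noteq> []\<close> by auto
  then have "last u \<in> K" using spans_conn[OF K] by simp
  moreover have "lev z = h + 1" using adj_lev[OF s(2)] lu(2) u(2) by linarith
  ultimately have "z \<in> up h K" unfolding up_def using s(2) by blast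
  moreover have "z \<in> K'" using ws(5) u(1) by auto
  ultimately show ?thesis by blast
qed

lemma escape_down:
  assumes "K \<in> spans l h" "a \<in> K" "K' \<in> spans l' h'" "a \<in> K'" "h' \<le> h" "l' < l"
  shows "\<exists>z\<in>down l K. z \<in> K'"
  using level_graph.escape_up[OF level_graph_dual, of K "- h" "- l" a K' "- h'" "- l'"] assms
  unfolding spans_dual up_dual by simp

text \<open>The exits found lie in the disjoint components \<open>K'\<close> and \<open>L'\<close>
  and are therefore distinct. In \<open>refine\<close> this separates blocked pairs over different
  intervals and protects comparisons over longer ones.\<close>

lemma not_blocked:
  assumes K: "K \<in> spans l h" "a \<in> K" and L: "L \<in> spans l h" "b \<in> L"
    and K': "K' \<in> spans l' h'" "a \<in> K'" and L': "L' \<in> spans l' h'" "b \<in> L'" and "K' \<noteq> L'"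
    and "(l \<le> l' \<and> h < h') \<or> (h' \<le> h \<and> l' < l)"
  shows "\<not> blocked l h K L"
  using assms(10)
proof
  assume "l \<le> l' \<and> h < h'"
  then obtain z z' where "z \<in> up h K" "z \<in> K'" "z' \<in> up h L" "z' \<in> L'"
    using escape_up[OF K K'] escape_up[OF L L'] by blast
  then show ?thesis
    using spans_disjoint[OF K'(1) L'(1) \<open>K' \<noteq> L'\<close>] unfolding blocked_def by blast
next
  assume "h' \<le> h \<and> l' < l"
  then obtain z z' where "z \<in> down l K" "z \<in> K'" "z' \<in> down l L" "z' \<in> L'"
    using escape_down[OF K K'] escape_down[OF L L'] by blast
  then show ?thesis
    using spans_disjoint[OF K'(1) L'(1) \<open>K' \<noteq> L'\<close>] unfolding blocked_def by blast
qed

lemma blocked_sym: "blocked l h K L \<longleftrightarrow> blocked l h L K"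
  unfolding blocked_def by blast

end

section \<open>Acyclicity of the determined comparisons and the refinement step\<close>

context signed_level_graph
begin

lemma signed_dual: "signed_level_graph adj (\<lambda>v. - lev v) x"
proof -
  interpret dual: level_graph adj "\<lambda>v. - lev v" by (rule level_graph_dual)
  show ?thesis by unfold_locales (simp add: signing_dual x)
qed

interpretation dual: signed_level_graph adj "\<lambda>v. - lev v" x
  by (rule signed_dual)

text \<open>The dual relation compares on level \<open>l\<close>, which agrees with level
  \<open>h\<close> by \<open>below_bot\<close>.\<close>

lemma below_dual:
  assumes "K \<in> spans l h" "L \<in> spans l h" "K \<noteq> L"
  shows "dual.below (- l) K L \<longleftrightarrow> below h K L"
proof -
  have "K \<in> dual.spans (- h) (- l)" "L \<in> dual.spans (- h) (- l)"
    using assms by (simp_all add: spans_dual)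
  moreover obtain a where "a \<in> K" "lev a = l" using spans_bot[OF assms(1)] .
  moreover obtain b where "b \<in> L" "lev b = l" using spans_bot[OF assms(2)] .
  ultimately show ?thesis
    using dual.below_top[of K "- h" "- l" L a b] below_bot[OF assms, of a b] assms(3) by simp
qed

lemma cyclic_dual: "dual.cyclic (- h) (- l) K L M \<longleftrightarrow> cyclic l h K L M"
  unfolding dual.cyclic_def cyclic_def spans_dual using below_dual by blast

lemma consistent_dual: "dual.consistent (- h) (- l) \<longleftrightarrow> consistent l h"
  unfolding dual.consistent_def consistent_def cyclic_dual ..

lemma cyclic_down:
  assumes "cyclic l h K L M" "consistent (l - 1) h"
    and "down l K \<noteq> {}" "down l L \<noteq> {}" "down l M \<noteq> {}"
  shows "\<exists>z. down l K = {z} \<and> down l L = {z} \<and> down l M = {z}"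
  using dual.cyclic_up[of "- h" "- l" K L M] consistent_dual[of h "l - 1"] assms
  unfolding cyclic_dual up_dual by simp

text \<open>The comparisons that the refinement step must not change.\<close>

definition determined :: "int \<Rightarrow> int \<Rightarrow> 'a set \<Rightarrow> 'a set \<Rightarrow> bool" where
  "determined l h K L \<longleftrightarrow> K \<in> spans l h \<and> L \<in> spans l h \<and> K \<noteq> L \<and> \<not> blocked l h K L \<and> below h K L"

lemma determined_asym: "determined l h K L \<Longrightarrow> \<not> below h L K"
  unfolding determined_def using below_anti by blast

text \<open>By \<open>cyclic_up\<close>, either one exit set above is empty or all three are the
  same singleton, so at most one of the three pairs has distinct exits above. The same holds below,
  but all three pairs must be separated on some side.\<close>

lemma determined_no_triangle:
  assumes cons: "consistent l (h + 1)" "consistent (l - 1) h"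
    and D: "determined l h K L" "determined l h L M" "determined l h M K"
  shows False
proof -
  have cyc: "cyclic l h K L M" using D unfolding determined_def cyclic_def by blast
  have nb: "\<not> blocked l h K L" "\<not> blocked l h L M" "\<not> blocked l h M K"
    using D unfolding determined_def by auto
  have "up h K = {} \<or> up h L = {} \<or> up h M = {} \<or> (\<exists>z. up h K = {z} \<and> up h L = {z} \<and> up h M = {z})"
    using cyclic_up[OF cyc cons(1)] by blast
  moreover have "down l K = {} \<or> down l L = {} \<or> down l M = {} \<or>
      (\<exists>z. down l K = {z} \<and> down l L = {z} \<and> down l M = {z})"
    using cyclic_down[OF cyc cons(2)] by blast
  ultimately show False using nb unfolding blocked_def by (elim disjE exE conjE) simp_all
qed

lemma determined_trans:
  assumes cons: "consistent l (h + 1)" "consistent (l - 1) h"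
    and D: "determined l h K L" "determined l h L M"
  shows "determined l h K M \<or> blocked l h K M"
proof -
  have "K \<noteq> M" using D determined_asym[OF D(1)] unfolding determined_def by blast
  then show ?thesis
    using determined_no_triangle[OF cons D] D below_anti[of K l h M] blocked_sym[of l h]
    unfolding determined_def by blast
qed

text \<open>Both comparisons equal that of the shared exit \<open>z\<close> with
  \<open>z'\<close>.\<close>

lemma below_common:
  assumes "K \<in> spans l h" "L \<in> spans l h" "M \<in> spans l h" "K \<noteq> L" "M \<noteq> L"
    and "z \<in> up h K \<and> z \<in> up h M \<and> z' \<in> up h L \<or> z \<in> down l K \<and> z \<in> down l M \<and> z' \<in> down l L" "z \<noteq> z'"
  shows "below h K L \<longleftrightarrow> below h M L"
  using assms below_up[of K l h L z z'] below_up[of M l h L z z']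
    below_down[of K l h L z z'] below_down[of M l h L z z'] by blast

text \<open>If \<open>L\<close> had no exits on one side, it would be separated from
  \<open>K\<close> and from \<open>M\<close> on the other. There the blocked pair \<open>K\<close>,
  \<open>M\<close> shares its exit, so both lie on the same side of \<open>L\<close>, which
  contradicts \<open>L\<close> being between them.\<close>

lemma determined_middle:
  assumes D: "determined l h K L" "determined l h L M" and b: "blocked l h K M"
  shows "up h L \<noteq> {}" "down l L \<noteq> {}"
proof -
  have S: "K \<in> spans l h" "L \<in> spans l h" "M \<in> spans l h" "K \<noteq> L" "M \<noteq> L"
    "below h K L" "\<not> below h M L" "\<not> blocked l h K L" "\<not> blocked l h L M"
    using D determined_asym[OF D(2)] unfolding determined_def by auto
  note no = below_common[OF S(1-5)]
  show "up h L \<noteq> {}"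
  proof
    assume e: "up h L = {}"
    obtain z z' where z: "z \<in> down l K" "z' \<in> down l L" "z \<noteq> z'"
      using S(8) e unfolding blocked_def by auto
    obtain w where "w \<in> down l M" using S(9) e unfolding blocked_def by auto
    then have "z \<in> down l M" using b z(1) unfolding blocked_def by blast
    then show False using no[of z z'] z S(6,7) by blast
  qed
  show "down l L \<noteq> {}"
  proof
    assume e: "down l L = {}"
    obtain z z' where z: "z \<in> up h K" "z' \<in> up h L" "z \<noteq> z'"
      using S(8) e unfolding blocked_def by auto
    obtain w where "w \<in> up h M" using S(9) e unfolding blocked_def by auto
    then have "z \<in> up h M" using b z(1) unfolding blocked_def by blast
    then show False using no[of z z'] z S(6,7) by blast
  qed
qed

text \<open>With exits on both sides, \<open>M\<close> shares an exit with \<open>K\<close> wherever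
  \<open>K\<close> is separated from \<open>L\<close>, and so lies on the same side of
  \<open>L\<close> as \<open>K\<close>.\<close>

lemma determined_twins:
  assumes D: "determined l h K L" "determined l h L M" and b: "blocked l h K M"
    and ne: "up h M \<noteq> {}" "down l M \<noteq> {}"
  shows False
proof -
  have S: "K \<in> spans l h" "L \<in> spans l h" "M \<in> spans l h" "K \<noteq> L" "M \<noteq> L"
    "below h K L" "\<not> below h M L" "\<not> blocked l h K L"
    using D determined_asym[OF D(2)] unfolding determined_def by auto
  note no = below_common[OF S(1-5)]
  have "(\<exists>z\<in>up h K. \<exists>z'\<in>up h L. z \<noteq> z') \<or> (\<exists>z\<in>down l K. \<exists>z'\<in>down l L. z \<noteq> z')"
    using S(8) unfolding blocked_def by blast
  then show False
  proof (elim disjE bexE)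
    fix z z' assume z: "z \<in> up h K" "z' \<in> up h L" "z \<noteq> z'"
    then have "z \<in> up h M" using b ne(1) unfolding blocked_def by blast
    then show False using no[of z z'] z S(6,7) by blast
  next
    fix z z' assume z: "z \<in> down l K" "z' \<in> down l L" "z \<noteq> z'"
    then have "z \<in> down l M" using b ne(2) unfolding blocked_def by blast
    then show False using no[of z z'] z S(6,7) by blast
  qed
qed

text \<open>
  Three consecutive members of a shortest cycle form a blocked pair around the middle one; this gives
  the middle one exits on both sides, and then the outer two share an exit and lie on the same
  side of the middle one.
\<close>

lemma determined_acyclic:
  assumes cons: "consistent l (h + 1)" "consistent (l - 1) h"
  shows "acyclic {(K, L). determined l h K L}"
proof (rule ccontr)
  let ?D = "determined l h"
  let ?C = "\<lambda>n K. n > 0 \<and> (?D ^^ n) K K"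
  assume "\<not> ?thesis"
  then obtain K where "(K, K) \<in> {(K, L). ?D K L}\<^sup>+" unfolding acyclic_def by blast
  then have "?D\<^sup>+\<^sup>+ K K" by (simp add: tranclp_unfold)
  then have ex: "\<exists>n K. ?C n K" unfolding tranclp_power by blast
  define n where "n = (LEAST n. \<exists>K. ?C n K)"
  obtain K where K: "?C n K" using LeastI_ex[OF ex] unfolding n_def by blast
  have least: "\<not> ?C m L" if "m < n" for m L
    using not_less_Least[of m "\<lambda>n. \<exists>K. ?C n K"] that unfolding n_def by blast
  have irr: "\<not> ?D L L" for L unfolding determined_def by blast
  have asym: "\<not> ?D M L" if "?D L M" for L M using determined_asym[OF that] unfolding determined_def by blast
  have "n \<noteq> 1" "n \<noteq> 2"
    using K irr asym by (auto simp: numeral_2_eq_2 OO_def)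
  then obtain m where m: "n = Suc (Suc m)" "m > 0" using K by (cases n; cases "n - 1"; auto)
  \<comment> \<open>\<open>J\<close> and \<open>L\<close> are the neighbours of \<open>K\<close> on
    a shortest cycle. A determined comparison of \<open>J\<close> with \<open>L\<close> would
    shorten it, so \<open>determined_trans\<close> makes the pair blocked. The cycle also passes
    through \<open>L\<close>, where the step can be repeated.\<close>
  have step: "\<exists>J L. ?D J K \<and> ?D K L \<and> blocked l h J L \<and> ?C n L" if "?C n K" for K
  proof -
    have "(?D ^^ Suc (Suc m)) K K" using that m by simp
    then obtain L where L: "?D K L" "(?D ^^ Suc m) L K" by (meson relpowp_Suc_D2)
    then obtain J where J: "(?D ^^ m) L J" "?D J K" by (meson relpowp_Suc_E)
    have "\<not> ?D J L"
    proof
      assume "?D J L"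
      then have "(?D ^^ Suc m) J J" using J(1) by (meson relpowp_Suc_I2)
      then show False using least[of "Suc m" J] m by blast
    qed
    then have "blocked l h J L" using determined_trans[OF cons J(2) L(1)] by blast
    moreover have "(?D ^^ n) L L" using relpowp_Suc_I[OF L(2,1)] m by simp
    ultimately show ?thesis using J L K by blast
  qed
  then obtain J L where JL: "?D J K" "?D K L" "blocked l h J L" "?C n L" using K by blast
  \<comment> \<open>Now \<open>L\<close> is itself the middle of such a triple, which gives it exits
    on both sides.\<close>
  obtain J' L' where "?D J' L" "?D L L'" "blocked l h J' L'" using step[OF JL(4)] by blast
  then have "up h L \<noteq> {}" "down l L \<noteq> {}" using determined_middle by blast+
  then show False using determined_twins[OF JL(1-3)] by blast
qed

text \<open>One step of the descending induction. The signs of pairs blocked over intervals of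
  length \<open>n\<close> are replaced by those of a linear extension of \<open>determined\<close>;
  all other signs are kept.\<close>

lemma refine:
  assumes n: "n \<ge> 0" and cons: "\<And>l h. n + 1 \<le> h - l \<Longrightarrow> consistent l h"
  obtains y where "signed_level_graph adj lev y"
    "\<And>l h. n \<le> h - l \<Longrightarrow> signed_level_graph.consistent adj lev y l h"
proof -
  have "\<exists>rk :: 'a set \<Rightarrow> nat. inj_on rk (spans l (l + n)) \<and>
      (\<forall>K L. determined l (l + n) K L \<longrightarrow> rk K < rk L)" for l
  proof -
    have "acyclic {(K, L). determined l (l + n) K L}"
      by (rule determined_acyclic) (use cons in auto)
    from finite_acyclic_rank[OF _ this, of "spans l (l + n)"] show ?thesis
      unfolding determined_def by auto
  qed
  then obtain rk :: "int \<Rightarrow> 'a set \<Rightarrow> nat" where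
    rk: "\<And>l. inj_on (rk l) (spans l (l + n))"
      "\<And>l K L. determined l (l + n) K L \<Longrightarrow> rk l K < rk l L" by metis
  define C where "C l a = comp l (l + n) a" for l a
  have C: "a \<in> C l a" for l a unfolding C_def comp_def by simp
  have C_eq: "K \<in> spans l (l + n) \<Longrightarrow> a \<in> K \<Longrightarrow> C l a = K" for K l a
    unfolding C_def using spans_eq_comp by blast
  define box where "box l a b \<longleftrightarrow> C l a \<in> spans l (l + n) \<and> C l b \<in> spans l (l + n) \<and> C l a \<noteq> C l b \<and>
    blocked l (l + n) (C l a) (C l b)" for l a b
  have box_sym: "box l a b \<longleftrightarrow> box l b a" for l a b
    unfolding box_def using blocked_sym by metis
  \<comment> \<open>A pair blocked over one interval lies in distinct components over the shifted
    interval, so \<open>not_blocked\<close> applies. Hence a pair of points is boxed for at most one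
    \<open>l\<close>, and \<open>y\<close> is well defined.\<close>
  have le: "\<not> l < l'" if "box l a b" "box l' a b" for l l' a b
  proof
    assume "l < l'"
    then show False
      using not_blocked[of "C l a" l "l + n" a "C l b" b "C l' a" l' "l' + n" "C l' b"] that C
      unfolding box_def by simp
  qed
  then have uniq: "l = l'" if "box l a b" "box l' a b" for l l' a b using that by (metis linorder_neqE_linordered_idom)
  define y where "y a b \<longleftrightarrow> (if \<exists>l. box l a b then \<exists>l. box l a b \<and> rk l (C l a) < rk l (C l b) else x a b)" for a b
  have y_box: "y a b \<longleftrightarrow> rk l (C l a) < rk l (C l b)" if "box l a b" for l a b
    unfolding y_def using that uniq by auto
  have y_free: "y a b \<longleftrightarrow> x a b" if "\<nexists>l. box l a b" for a b
    unfolding y_def using that by auto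
  \<comment> \<open>Two points on one level leave the strip at the same moment, and a blocked pair
    offers no distinct places to go. So simultaneous moves stay inside the box, and the new signs
    are invariant.\<close>
  have box_step: "box l a' b' \<and> C l a' = C l a \<and> C l b' = C l b"
    if b: "box l a b" and "a' \<noteq> b'" "lev a = lev b" "lev a' = lev b'" "adj a a'" "adj b b'" for l a b a' b'
  proof -
    have S: "C l a \<in> spans l (l + n)" "C l b \<in> spans l (l + n)" and bl: "blocked l (l + n) (C l a) (C l b)"
      using b unfolding box_def by auto
    have r: "l \<le> lev a" "lev a \<le> l + n" using spans_lev[OF S(1) C] by auto
    have "lev a' \<noteq> l + n + 1"
    proof
      assume "lev a' = l + n + 1"
      then have "a' \<in> up (l + n) (C l a)" "b' \<in> up (l + n) (C l b)"
        using that C unfolding up_def by auto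
      then show False using bl that(2) unfolding blocked_def by blast
    qed
    moreover have "lev a' \<noteq> l - 1"
    proof
      assume "lev a' = l - 1"
      then have "a' \<in> down l (C l a)" "b' \<in> down l (C l b)"
        using that C unfolding down_def by auto
      then show False using bl that(2) unfolding blocked_def by blast
    qed
    ultimately have "l \<le> lev a'" "lev a' \<le> l + n" using r adj_lev[OF that(5)] by auto
    then have "a' \<in> C l a" "b' \<in> C l b"
      unfolding C_def comp_def using conn_adj that r by auto
    then have "C l a' = C l a" "C l b' = C l b" using C_eq[OF S(1)] C_eq[OF S(2)] by blast+
    then show ?thesis using b unfolding box_def by simp
  qed
  have "signing y"
    unfolding signing_def
  proof (intro conjI allI impI)
    fix a b assume ab: "a \<noteq> b" "lev a = lev b"
    show "y a b \<longleftrightarrow> \<not> y b a"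
    proof (cases "\<exists>l. box l a b")
      case True
      then obtain l where l: "box l a b" by blast
      have "rk l (C l a) \<noteq> rk l (C l b)"
        using l inj_onD[OF rk(1)[of l]] unfolding box_def by blast
      then show ?thesis using y_box[OF l] y_box[of l b a] l box_sym by auto
    next
      case False
      then show ?thesis using y_free box_sym signing_anti[OF x ab] by metis
    qed
  next
    fix a b a' b'
    assume ab: "a \<noteq> b" "a' \<noteq> b'" "lev a = lev b" "lev a' = lev b'" "adj a a'" "adj b b'"
    show "y a b \<longleftrightarrow> y a' b'"
    proof (cases "\<exists>l. box l a b")
      case True
      then obtain l where l: "box l a b" by blast
      show ?thesis using y_box[OF l] box_step[OF l ab(2-6)] y_box[of l a' b'] by simp
    next
      case False
      have "\<nexists>l. box l a' b'"
        using box_step[of _ a' b' a b] ab adj_sym False by metis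
      then show ?thesis using False y_free signing_step[OF x ab] by metis
    qed
  qed
  then interpret y: signed_level_graph adj lev y by unfold_locales
  \<comment> \<open>Top vertices of components over an interval of length at least \<open>n\<close>
    are boxed only if that interval is the box's own: it cannot end above the box, and starting
    below it would contradict \<open>not_blocked\<close>. Longer intervals thus keep their
    comparisons.\<close>
  have inner: "blocked l h K L" "h - l = n"
    if K: "K \<in> spans l h" "a \<in> K" "lev a = h" and L: "L \<in> spans l h" "b \<in> L" "lev b = h"
      and "K \<noteq> L" "n \<le> h - l" "box m a b" for K L a b l h m
  proof -
    have S: "C m a \<in> spans m (m + n)" "C m b \<in> spans m (m + n)" "blocked m (m + n) (C m a) (C m b)"
      using that(9) unfolding box_def by auto
    have m: "h \<le> m + n" using spans_lev(2)[OF S(1) C] K(3) by simp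
    have "\<not> l < m"
      using not_blocked[OF S(1) C S(2) C K(1,2) L(1,2) \<open>K \<noteq> L\<close>] S(3) m by blast
    then have "l = m" "h = m + n" using m that(8) by auto
    then show "blocked l h K L" "h - l = n" using S(3) C_eq K L by auto
  qed
  have "y.consistent l h" if nl: "n \<le> h - l" for l h
  proof -
    have outer: "below h K L"
      if y: "y.below h K L" and "K \<in> spans l h" "L \<in> spans l h" "K \<noteq> L" "n < h - l \<or> \<not> blocked l h K L" for K L
    proof -
      obtain a b where ab: "a \<in> K" "b \<in> L" "lev a = h" "lev b = h" "y a b" using y unfolding y.below_def by blast
      then have "\<nexists>m. box m a b" using inner[of K l h a L b] that nl by force
      then show ?thesis using ab y_free unfolding below_def by blast
    qed
    show ?thesis
    proof (cases "h - l = n")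
      case False
      have "cyclic l h K L M" if "y.cyclic l h K L M" for K L M
        using that outer False nl unfolding y.cyclic_def cyclic_def by auto
      then show ?thesis using cons[of h l] False nl unfolding consistent_def y.consistent_def by auto
    next
      case True
      then have h: "h = l + n" by simp
      \<comment> \<open>Over length \<open>n\<close> a comparison either was rewritten by rank or is
        determined, and the ranks extend the determined ones. So \<open>y.below\<close> always
        increases the rank and has no cycles.\<close>
      have rank: "rk l K < rk l L" if b: "y.below h K L" and S: "K \<in> spans l h" "L \<in> spans l h" and "K \<noteq> L" for K L
      proof (cases "blocked l h K L")
        case True
        obtain a b where ab: "a \<in> K" "b \<in> L" "y a b" using b unfolding y.below_def by blast
        then have "C l a = K" "C l b = L" using C_eq S h by auto
        then show ?thesis using y_box[of l a b] ab S h True \<open>K \<noteq> L\<close> unfolding box_def by simp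
      next
        case False
        then show ?thesis using outer[OF b S \<open>K \<noteq> L\<close>] rk(2)[of l K L] S \<open>K \<noteq> L\<close> unfolding determined_def h by blast
      qed
      show ?thesis
        unfolding y.consistent_def
      proof (intro notI, elim exE)
        fix K L M assume "y.cyclic l h K L M"
        then have "rk l K < rk l L" "rk l L < rk l M" "rk l M < rk l K"
          unfolding y.cyclic_def using rank by auto
        then show False by simp
      qed
    qed
  qed
  then show ?thesis using that y.signed_level_graph_axioms by blast
qed

end

context level_graph
begin

section \<open>Linear orders on the levels\<close>

lemma ex_consistent:
  assumes "signing x"
  obtains y where "signed_level_graph adj lev y" "\<And>l h. l \<le> h \<Longrightarrow> signed_level_graph.consistent adj lev y l h"
proof -
  \<comment> \<open>Levels differ by at most \<open>2 * B\<close>, so nothing spans an interval of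
    length \<open>2 * B + 1\<close> and consistency holds there trivially. Each increment of
    \<open>m\<close> is one use of \<open>refine\<close>, ending at length 0.\<close>
  define B where "B = Max (range (\<lambda>v. \<bar>lev v\<bar>))"
  have B: "\<bar>lev v\<bar> \<le> B" for v unfolding B_def by simp
  have B0: "B \<ge> 0" using B[of undefined] by simp
  have "\<exists>y. signed_level_graph adj lev y \<and>
      (\<forall>l h. 2 * B + 1 - int m \<le> h - l \<longrightarrow> signed_level_graph.consistent adj lev y l h)"
    if "int m \<le> 2 * B + 1" for m
    using that
  proof (induction m)
    case 0
    interpret signed_level_graph adj lev x using assms by unfold_locales
    have "spans l h = {}" if "2 * B + 1 \<le> h - l" for l h
    proof (rule ccontr)
      assume "spans l h \<noteq> {}"
      then obtain a c where "lev a = h" "lev c = l" unfolding spans_def by blast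
      then show False using B[of a] B[of c] that by linarith
    qed
    then have "consistent l h" if "2 * B + 1 \<le> h - l" for l h
      using that unfolding consistent_def cyclic_def by blast
    then show ?case using signed_level_graph_axioms by auto
  next
    case (Suc m)
    then obtain y where y: "signed_level_graph adj lev y"
      "\<And>l h. 2 * B + 1 - int m \<le> h - l \<Longrightarrow> signed_level_graph.consistent adj lev y l h" by auto
    interpret signed_level_graph adj lev y by (rule y)
    obtain y' where "signed_level_graph adj lev y'"
      "\<And>l h. 2 * B + 1 - int (Suc m) \<le> h - l \<Longrightarrow> signed_level_graph.consistent adj lev y' l h"
      by (rule refine[of "2 * B + 1 - int (Suc m)"]) (use y Suc.prems in auto)
    then show ?case by blast
  qed
  from this[of "nat (2 * B + 1)"] show ?thesis using that B0 by auto
qed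

lemma conn_level: "conn w w a b \<Longrightarrow> a = b"
  unfolding conn_def by (induction rule: rtranclp_induct) (use adj_lev in \<open>force simp: band_def\<close>)+

text \<open>Over an interval of one level the spanning components are single vertices, so having no
  3-cycles means transitivity there. The rank of a vertex counts those under it on its
  level.\<close>

lemma ex_rank:
  assumes "signing x"
  shows "\<exists>r :: 'v \<Rightarrow> nat. (\<forall>a b. a \<noteq> b \<longrightarrow> lev a = lev b \<longrightarrow> r a \<noteq> r b) \<and>
    signing (\<lambda>a b. r a < r b)"
proof -
  obtain y where "signed_level_graph adj lev y"
    and cons: "\<And>l h. l \<le> h \<Longrightarrow> signed_level_graph.consistent adj lev y l h"
    using ex_consistent[OF assms] by blast
  then interpret y: signed_level_graph adj lev y by simp
  have trans: "y a c" if d: "a \<noteq> b" "b \<noteq> c" and l: "lev a = lev b" "lev b = lev c" and "y a b" "y b c" for a b c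
  proof (rule ccontr)
    assume n: "\<not> y a c"
    have "a \<noteq> c" using signing_anti[OF y.x d(1) l(1)] that by blast
    then have "y c a" using signing_anti[OF y.x, of a c] n l by simp
    have comp: "comp (lev v) (lev v) v = {v}" for v
      unfolding comp_def using conn_level conn_refl by blast
    have sp: "{v} \<in> spans (lev v) (lev v)" for v
      using spansI[of "lev v" "lev v" v v] comp by simp
    have "y.cyclic (lev a) (lev a) {a} {b} {c}"
      unfolding y.cyclic_def y.below_def using sp[of a] sp[of b] sp[of c] l d \<open>a \<noteq> c\<close> \<open>y c a\<close> that by auto
    then show False using cons[of "lev a" "lev a"] unfolding y.consistent_def by blast
  qed
  define S where "S v = {u. lev u = lev v \<and> u \<noteq> v \<and> y u v}" for v
  define r where "r v = card (S v)" for v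
  have less: "r a < r b" if ab: "a \<noteq> b" "lev a = lev b" "y a b" for a b
  proof -
    have "u \<in> S b" if "u \<in> S a" for u
    proof -
      have u: "lev u = lev a" "u \<noteq> a" "y u a" using that unfolding S_def by auto
      then have "u \<noteq> b" using signing_anti[OF y.x ab(1,2)] ab(3) by blast
      then show ?thesis using trans[OF u(2) ab(1) u(1) ab(2) u(3) ab(3)] u(1) ab(2) unfolding S_def by simp
    qed
    moreover have "a \<in> S b" "a \<notin> S a" using ab unfolding S_def by auto
    ultimately show ?thesis unfolding r_def by (intro psubset_card_mono) auto
  qed
  have iff: "y a b \<longleftrightarrow> r a < r b" if "a \<noteq> b" "lev a = lev b" for a b
    using less[of a b] less[of b a] signing_anti[OF y.x that] that by fastforce
  show ?thesis
  proof (intro exI[of _ r] conjI allI impI)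
    show "r a \<noteq> r b" if "a \<noteq> b" "lev a = lev b" for a b
      using iff[of a b] iff[of b a] signing_anti[OF y.x that] that by auto
    show "signing (\<lambda>a b. r a < r b)"
      using y.x iff unfolding signing_def by (metis (no_types, lifting))
  qed
qed

section \<open>Signings from the absence of swapping paths\<close>

definition pair_step :: "'v \<times> 'v \<Rightarrow> 'v \<times> 'v \<Rightarrow> bool" where
  "pair_step = (\<lambda>(a, b) (a', b'). a \<noteq> b \<and> a' \<noteq> b' \<and> lev a = lev b \<and> lev a' = lev b' \<and>
     adj a a' \<and> adj b b')"

text \<open>Each class of mutually reachable pairs is labelled by its least code \<open>m\<close>. A
  pair and its swap lie in different classes, so comparing their labels gives an antisymmetric sign
  that is constant on classes.\<close>

lemma ex_signing:
  assumes "\<And>a b. a \<noteq> b \<Longrightarrow> lev a = lev b \<Longrightarrow> \<not> pair_step\<^sup>*\<^sup>* (a, b) (b, a)"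
  shows "\<exists>x. signing x"
proof -
  obtain \<phi> :: "'v \<times> 'v \<Rightarrow> nat" where \<phi>: "inj \<phi>"
    using finite_imp_inj_to_nat_seg[of "UNIV :: ('v \<times> 'v) set"] by auto
  have "symp pair_step" by (auto simp: symp_def pair_step_def adj_sym)
  then have sym: "pair_step\<^sup>*\<^sup>* q p" if "pair_step\<^sup>*\<^sup>* p q" for p q
    using that by (metis sympD symp_rtranclp)
  define m where "m p = Min (\<phi> ` {q. pair_step\<^sup>*\<^sup>* p q})" for p
  have m_in: "m p \<in> \<phi> ` {q. pair_step\<^sup>*\<^sup>* p q}" for p
  proof -
    have "{q. pair_step\<^sup>*\<^sup>* p q} \<noteq> {}" by blast
    then show ?thesis unfolding m_def by (intro Min_in) auto
  qed
  have m_eq: "m p = m q" if "pair_step p q" for p q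
  proof -
    have "{s. pair_step\<^sup>*\<^sup>* p s} = {s. pair_step\<^sup>*\<^sup>* q s}"
      using that sym[of p q] by (auto intro: rtranclp_trans converse_rtranclp_into_rtranclp)
    then show ?thesis by (simp add: m_def)
  qed
  have m_neq: "m (a, b) \<noteq> m (b, a)" if "a \<noteq> b" "lev a = lev b" for a b
  proof
    assume "m (a, b) = m (b, a)"
    then obtain s where "pair_step\<^sup>*\<^sup>* (a, b) s" "pair_step\<^sup>*\<^sup>* (b, a) s"
      using m_in[of "(a, b)"] m_in[of "(b, a)"] \<phi> by (auto simp: inj_eq)
    then show False using assms[OF that] sym by (meson rtranclp_trans)
  qed
  show ?thesis
  proof
    show "signing (\<lambda>a b. m (a, b) < m (b, a))"
      unfolding signing_def
    proof (intro conjI allI impI)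
      fix a b assume "a \<noteq> b" "lev a = lev b"
      then show "m (a, b) < m (b, a) \<longleftrightarrow> \<not> m (b, a) < m (a, b)" using m_neq[of a b] by linarith
    next
      fix a b a' b'
      assume "a \<noteq> b" "a' \<noteq> b'" "lev a = lev b" "lev a' = lev b'" "adj a a'" "adj b b'"
      then show "m (a, b) < m (b, a) \<longleftrightarrow> m (a', b') < m (b', a')"
        using m_eq[of "(a, b)" "(a', b')"] m_eq[of "(b, a)" "(b', a')"] by (simp add: pair_step_def)
    qed
  qed
qed

end

section \<open>Realisations and lifts\<close>

lemma path_graph_edge_subset: "path_graph J \<Longrightarrow> e \<in> edges J \<Longrightarrow> e \<subseteq> verts J"
  unfolding path_graph_def by auto

lemma path_graph_levels:
  assumes "path_graph J"
  shows "\<exists>pos :: 'b \<Rightarrow> int. inj_on pos (verts J) \<and>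
    (\<forall>u v. {u, v} \<in> edges J \<longrightarrow> pos v = pos u + 1 \<or> pos v = pos u - 1)"
proof -
  obtain p where p: "distinct p" "verts J = set p" "edges J = {{p ! i, p ! Suc i} | i. Suc i < length p}"
    using assms unfolding path_graph_def by auto
  define pos where "pos w = int (inv_into {..<length p} ((!) p) w)" for w
  have inj: "inj_on ((!) p) {..<length p}" using p(1) by (auto simp: inj_on_def nth_eq_iff_index_eq)
  have pos: "pos (p ! i) = int i" if "i < length p" for i
    unfolding pos_def using inv_into_f_f[OF inj] that by simp
  show ?thesis
  proof (intro exI[of _ pos] conjI allI impI)
    show "inj_on pos (verts J)"
      unfolding p(2) by (auto simp: inj_on_def in_set_conv_nth pos)
    show "pos v = pos u + 1 \<or> pos v = pos u - 1" if "{u, v} \<in> edges J" for u v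
      using that unfolding p(3) by (auto simp: doubleton_eq_iff pos)
  qed
qed

lemma axis_nth_if: "axis i (1::real) $ j = (if j = i then 1 else 0)"
  by (simp add: axis_def)

lemma linear_realisation_map: "linear (realisation_map f)"
  by (rule linearI)
    (simp_all add: realisation_map_def scaleR_add_left sum.distrib scaleR_sum_right)

lemma realisation_map_axis: "realisation_map f (axis v 1) = axis (f v) 1"
proof -
  have "realisation_map f (axis v 1) = (\<Sum>u\<in>UNIV. if u = v then axis (f u) 1 else 0)"
    unfolding realisation_map_def by (intro sum.cong) (auto simp: axis_nth_if)
  then show ?thesis by simp
qed

definition edge_point :: "'a::finite \<Rightarrow> 'a \<Rightarrow> real \<Rightarrow> real ^ 'a" where
  "edge_point u v t = (1 - t) *\<^sub>R axis u 1 + t *\<^sub>R axis v 1"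

lemma linear_edge_point:
  "linear F \<Longrightarrow> F (edge_point u v t) = (1 - t) *\<^sub>R F (axis u 1) + t *\<^sub>R F (axis v 1)"
  by (simp add: edge_point_def linear_add linear_scale)

lemma edge_point_swap: "edge_point u v t = edge_point v u (1 - t)"
  by (simp add: edge_point_def)

lemma realisation_map_edge_point: "realisation_map f (edge_point u v t) = edge_point (f u) (f v) t"
  by (simp add: linear_edge_point[OF linear_realisation_map] realisation_map_axis) (simp add: edge_point_def)

lemma edge_point_nth:
  "edge_point u v t $ w = (1 - t) * (if w = u then 1 else 0) + t * (if w = v then 1 else 0)"
  by (simp add: edge_point_def axis_nth_if)

lemma edge_point_eq:
  assumes "edge_point a a' t = edge_point b b' s" "a \<noteq> a'" "b \<noteq> b'" "0 < t" "t < 1" "0 < s" "s < 1"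
  shows "a = b \<and> a' = b' \<and> t = s \<or> a = b' \<and> a' = b \<and> t = 1 - s"
proof -
  have "edge_point a a' t $ w = edge_point b b' s $ w" for w using assms(1) by simp
  from this[of a] this[of a'] show ?thesis
    using assms(2-) by (auto simp: edge_point_nth split: if_splits)
qed

lemma edge_point_neq_axis:
  assumes "a \<noteq> a'" "0 < t" "t < 1" shows "edge_point a a' t \<noteq> axis b 1"
proof
  assume "edge_point a a' t = axis b 1"
  then have "edge_point a a' t $ w = axis b 1 $ w" for w by simp
  from this[of a] this[of a'] show False
    using assms by (auto simp: edge_point_nth axis_nth_if split: if_splits)
qed

lemma convex_hull_edge: "convex hull ((\<lambda>v. axis v 1) ` {u, v}) = edge_point u v ` {0..1}"
  unfolding edge_point_def
  by (auto simp: segment_convex_hull[symmetric] closed_segment_def)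

lemma vertex_in_realisation: "v \<in> verts G \<Longrightarrow> axis v 1 \<in> realisation G"
  unfolding realisation_def simplices_def by force

lemma edge_point_in_realisation:
  "{u, v} \<in> edges G \<Longrightarrow> 0 \<le> t \<Longrightarrow> t \<le> 1 \<Longrightarrow> edge_point u v t \<in> realisation G"
  unfolding realisation_def simplices_def using convex_hull_edge[of u v] by force

lemma realisation_cases:
  assumes "y \<in> realisation G" "simple_graph G"
  obtains (vertex) v where "v \<in> verts G" "y = axis v 1"
    | (edge) u v t where "{u, v} \<in> edges G" "u \<noteq> v" "0 < t" "t < 1" "y = edge_point u v t"
proof -
  obtain s where s: "s \<in> simplices G" "y \<in> convex hull ((\<lambda>v. axis v 1) ` s)"
    using assms(1) unfolding realisation_def by blast
  show thesis
  proof (cases "s \<in> edges G")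
    case True
    then have "card s = 2" "s \<subseteq> verts G" using assms(2) unfolding simple_graph_def by auto
    then obtain u v where uv: "s = {u, v}" "u \<noteq> v" by (auto simp: card_2_iff)
    obtain t where t: "0 \<le> t" "t \<le> 1" "y = edge_point u v t"
      using s(2) convex_hull_edge[of u v] unfolding uv(1) by auto
    consider "t = 0" | "t = 1" | "0 < t" "t < 1" using t by linarith
    then show thesis
      using vertex[of u] vertex[of v] edge[of u v t] t uv True \<open>s \<subseteq> verts G\<close>
      by cases (auto simp: edge_point_def)
  next
    case False
    then obtain v where "v \<in> verts G" "s = {v}" using s(1) unfolding simplices_def by blast
    then show thesis using vertex[of v] s(2) by simp
  qed
qed

lemma compact_realisation: "compact (realisation G)" for G :: "'a::finite graph"
  unfolding realisation_def
  by (intro compact_UN) (auto intro!: finite_imp_compact_convex_hull)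

lemma realisation_map_image:
  assumes "simplicial_map f G H" "y \<in> realisation G"
  shows "realisation_map f y \<in> realisation H"
proof -
  obtain s where s: "s \<in> simplices G" "y \<in> convex hull ((\<lambda>v. axis v 1) ` s)"
    using assms(2) unfolding realisation_def by blast
  have "realisation_map f y \<in> convex hull (realisation_map f ` (\<lambda>v. axis v 1) ` s)"
    using s(2) convex_hull_linear_image[OF linear_realisation_map] by blast
  also have "realisation_map f ` (\<lambda>v. axis v 1) ` s = (\<lambda>v. axis v 1) ` f ` s"
    by (simp add: image_image realisation_map_axis)
  finally show ?thesis
    using assms(1) s(1) unfolding realisation_def simplicial_map_def by blast
qed

lemma piecewise_linear_on_realisation:
  assumes "linear F" shows "piecewise_linear_on (realisation G) F"
  unfolding piecewise_linear_on_def
proof (intro exI conjI ballI)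
  let ?C = "(\<lambda>s. convex hull ((\<lambda>v. axis v (1::real)) ` s)) ` simplices G"
  show "finite ?C" by simp
  show "realisation G = \<Union>?C" unfolding realisation_def ..
  fix C assume "C \<in> ?C"
  then show "polytope C" by (auto intro!: polytope_convex_hull)
  show "affine_map_on C F"
    unfolding affine_map_on_def using assms by (simp add: linear_add linear_scale)
qed

lemma simplicial_vertex:
  assumes "path_graph J" "simplicial_map f T J" "v \<in> verts T" shows "f v \<in> verts J"
proof -
  have "{v} \<in> simplices T" using assms(3) unfolding simplices_def by blast
  then have "f ` {v} \<in> simplices J" using assms(2) unfolding simplicial_map_def by blast
  then show ?thesis using path_graph_edge_subset[OF assms(1)] unfolding simplices_def by auto
qed

text \<open>If an edge were collapsed, \<open>f\<close> would be non-injective on the stars of both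
  its ends: two non-regular vertices in one fibre, which stability forbids for every degree.\<close>

lemma stable_map_edge:
  assumes "simple_graph T" "path_graph J" "simplicial_map f T J" "stable_map f T J" "{u, v} \<in> edges T"
  shows "f u \<noteq> f v" "{f u, f v} \<in> edges J"
proof -
  have uv: "u \<noteq> v" "u \<in> verts T" "v \<in> verts T" using assms(1,5) unfolding simple_graph_def by force+
  show "f u \<noteq> f v"
  proof
    assume eq: "f u = f v"
    have "\<not> inj_on f (star T w)" if "w \<in> {u, v}" for w
      using that uv(1) assms(5) eq unfolding star_def inj_on_def by blast
    then have "\<not> regular_vertex f T J u" "\<not> regular_vertex f T J v"
      unfolding regular_vertex_def bij_betw_def by auto
    then show False
      using assms(4) simplicial_vertex[OF assms(2,3) uv(2)] uv eq unfolding stable_map_def by metis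
  qed
  moreover have "f ` {u, v} \<in> simplices J"
    using assms(3,5) unfolding simplicial_map_def simplices_def by blast
  ultimately show "{f u, f v} \<in> edges J" unfolding simplices_def by auto
qed

section \<open>The double point graph and the two implications\<close>

lemma double_point_verts:
  "(a, b) \<in> verts (double_point_graph f G) \<longleftrightarrow> a \<in> verts G \<and> b \<in> verts G \<and> a \<noteq> b \<and> f a = f b"
  by (simp add: double_point_graph_def Let_def)

lemma double_point_edges:
  "{p, q} \<in> edges (double_point_graph f G) \<longleftrightarrow>
     p \<in> verts (double_point_graph f G) \<and> q \<in> verts (double_point_graph f G) \<and>
     {fst p, fst q} \<in> edges G \<and> {snd p, snd q} \<in> edges G"
proof
  assume "{p, q} \<in> edges (double_point_graph f G)"
  then show "p \<in> verts (double_point_graph f G) \<and> q \<in> verts (double_point_graph f G) \<and>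
     {fst p, fst q} \<in> edges G \<and> {snd p, snd q} \<in> edges G"
    by (auto simp: double_point_graph_def Let_def doubleton_eq_iff insert_commute)
next
  assume "p \<in> verts (double_point_graph f G) \<and> q \<in> verts (double_point_graph f G) \<and>
     {fst p, fst q} \<in> edges G \<and> {snd p, snd q} \<in> edges G"
  then show "{p, q} \<in> edges (double_point_graph f G)"
    unfolding double_point_graph_def Let_def
    by (cases p; cases q) (simp, rule exI, rule exI, rule exI, rule exI, rule conjI[OF refl], simp)
qed

text \<open>The ranks serve as heights of the vertices, extended linearly. Two edges over the same
  edge of \<open>J\<close> keep their order from end to end, so they meet only at common vertices;
  compactness turns the injective map into an embedding.\<close>

lemma lift_of_ranks:
  fixes T :: "'a::finite graph" and J :: "'b::finite graph" and f :: "'a \<Rightarrow> 'b" and r :: "'a \<Rightarrow> real"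
  assumes T: "simple_graph T" and f: "simplicial_map f T J"
    and inj: "\<And>u v. {u, v} \<in> edges T \<Longrightarrow> f u \<noteq> f v"
    and neq: "\<And>u v. u \<in> verts T \<Longrightarrow> v \<in> verts T \<Longrightarrow> u \<noteq> v \<Longrightarrow> f u = f v \<Longrightarrow> r u \<noteq> r v"
    and step: "\<And>u v u' v'. {u, u'} \<in> edges T \<Longrightarrow> {v, v'} \<in> edges T \<Longrightarrow> u \<noteq> v \<Longrightarrow> u' \<noteq> v' \<Longrightarrow>
      f u = f v \<Longrightarrow> f u' = f v' \<Longrightarrow> r u < r v \<longleftrightarrow> r u' < r v'"
  shows "lifts_to_embedding f T J"
proof -
  define h where "h y = (\<Sum>v\<in>UNIV. (y $ v) * r v)" for y :: "real ^ 'a"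
  define F where "F y = (realisation_map f y, h y)" for y
  have "linear h"
    by (rule linearI) (simp_all add: h_def distrib_right sum.distrib sum_distrib_left mult.assoc)
  then have F: "linear F"
    using linear_realisation_map[of f] unfolding F_def linear_iff by simp
  have h_axis: "h (axis v 1) = r v" for v
  proof -
    have "h (axis v 1) = (\<Sum>u\<in>UNIV. if u = v then r u else 0)"
      unfolding h_def by (intro sum.cong) (auto simp: axis_nth_if)
    then show ?thesis by simp
  qed
  have h_edge: "h (edge_point u v t) = (1 - t) * r u + t * r v" for u v t
    using linear_edge_point[OF \<open>linear h\<close>] by (simp add: h_axis)
  have verts: "u \<in> verts T" "v \<in> verts T" if "{u, v} \<in> edges T" for u v
    using that T unfolding simple_graph_def by auto
  have edges_inj: "edge_point u u' t = edge_point v v' t"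
    if e: "{u, u'} \<in> edges T" "{v, v'} \<in> edges T" and eq: "f u = f v" "f u' = f v'" and t: "0 < t" "t < 1"
      and h: "(1 - t) * r u + t * r u' = (1 - t) * r v + t * r v'" for u u' v v' t
  proof -
    \<comment> \<open>The height difference is a combination, with positive weights, of the
      differences at the two ends: equal signs cannot cancel, and vanishing at one end forces it at
      the other. Opposite signs are excluded by \<open>step\<close>.\<close>
    have "\<not> (r u < r v \<and> r u' < r v')" "\<not> (r v < r u \<and> r v' < r u')"
      using h t by (smt (verit) mult_strict_left_mono)+
    moreover have "r u = r v \<longleftrightarrow> r u' = r v'"
      using h t by auto
    ultimately have "u = v \<and> u' = v'"
      using step[OF e _ _ eq] neq[of u v] neq[of u' v'] verts[OF e(1)] verts[OF e(2)] eq
      by (metis linorder_neqE_linordered_idom)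
    then show ?thesis by simp
  qed
  have "inj_on F (realisation T)"
  proof (rule inj_onI)
    fix y y' assume y: "y \<in> realisation T" and y': "y' \<in> realisation T" and "F y = F y'"
    then have eq: "realisation_map f y = realisation_map f y'" "h y = h y'" unfolding F_def by auto
    from y T show "y = y'"
    proof (cases rule: realisation_cases)
      case (vertex u)
      from y' T show ?thesis
      proof (cases rule: realisation_cases)
        case (vertex v)
        then show ?thesis
          using \<open>y = axis u 1\<close> \<open>u \<in> verts T\<close> eq neq[of u v]
          by (auto simp: realisation_map_axis h_axis axis_eq_axis)
      next
        case (edge v v' t)
        then show ?thesis
          using \<open>y = axis u 1\<close> eq(1) edge_point_neq_axis[OF inj[OF edge(1)] edge(3,4), of "f u"]
          by (simp add: realisation_map_axis realisation_map_edge_point)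
      qed
    next
      case (edge u u' t)
      note e = edge
      from y' T show ?thesis
      proof (cases rule: realisation_cases)
        case (vertex v)
        then show ?thesis
          using e eq(1) edge_point_neq_axis[OF inj[OF e(1)] e(3,4), of "f v"]
          by (simp add: realisation_map_axis realisation_map_edge_point)
      next
        case (edge v v' s)
        have "edge_point (f u) (f u') t = edge_point (f v) (f v') s"
          using eq(1) e(5) edge(5) by (simp add: realisation_map_edge_point)
        then consider "f u = f v" "f u' = f v'" "t = s" | "f u = f v'" "f u' = f v" "s = 1 - t"
          using edge_point_eq inj[OF e(1)] inj[OF edge(1)] e(3,4) edge(3,4) by fastforce
        then show ?thesis
        proof cases
          case 1
          then show ?thesis
            using edges_inj[OF e(1) edge(1) 1(1,2) e(3,4)] eq(2) e(5) edge(5) by (simp add: h_edge)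
        next
          case 2
          have "{v', v} \<in> edges T" using edge(1) by (simp add: insert_commute)
          moreover have "y' = edge_point v' v t" using edge(5) 2 edge_point_swap[of v v' s] by simp
          ultimately show ?thesis
            using edges_inj[OF e(1) _ 2(1,2) e(3,4)] eq(2) e(5) by (simp add: h_edge)
        qed
      qed
    qed
  qed
  moreover have "continuous_on (realisation T) F"
    using F by (rule linear_continuous_on_compose[OF continuous_on_id, unfolded id_def])
  ultimately have "\<exists>g. homeomorphism (realisation T) (F ` realisation T) F g"
    using homeomorphism_compact[OF compact_realisation] by blast
  moreover have "F ` realisation T \<subseteq> realisation J \<times> UNIV"
    using realisation_map_image[OF f] unfolding F_def by auto
  ultimately have "pl_embedding_on (realisation T) (realisation J \<times> UNIV) F"
    unfolding pl_embedding_on_def using piecewise_linear_on_realisation[OF F] by blast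
  moreover have "\<forall>y\<in>realisation T. realisation_map f y = fst (F y)" unfolding F_def by simp
  ultimately show ?thesis unfolding lifts_to_embedding_def by blast
qed

text \<open>The order of the heights of the two points is constant along paths in the double point
  graph, by the intermediate value theorem and injectivity of the lift. An obstructor would reverse
  it.\<close>

lemma lift_no_two_obstructor:
  fixes T :: "'a::finite graph" and J :: "'b::finite graph" and f :: "'a \<Rightarrow> 'b"
  assumes inj: "\<And>u v. {u, v} \<in> edges T \<Longrightarrow> f u \<noteq> f v"
    and lift: "lifts_to_embedding f T J"
  shows "\<not> two_obstructor f T q p"
proof
  assume obs: "two_obstructor f T q p"
  obtain F :: "real ^ 'a \<Rightarrow> (real ^ 'b) \<times> real" where
    emb: "pl_embedding_on (realisation T) (realisation J \<times> UNIV) F"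
    and fst: "\<forall>x\<in>realisation T. realisation_map f x = fst (F x)"
    using lift unfolding lifts_to_embedding_def by blast
  obtain g where g: "homeomorphism (realisation T) (F ` realisation T) F g"
    using emb unfolding pl_embedding_on_def by blast
  have injF: "inj_on F (realisation T)"
    using g unfolding homeomorphism_def by (metis inj_on_inverseI)
  define h where "h y = snd (F y)" for y
  have h: "continuous_on (realisation T) h"
    unfolding h_def using homeomorphism_cont1[OF g] by (rule continuous_on_snd)
  have inj_h: "y = y'" if "y \<in> realisation T" "y' \<in> realisation T"
    "realisation_map f y = realisation_map f y'" "h y = h y'" for y y'
    using inj_onD[OF injF _ that(1,2)] that fst unfolding h_def by (simp add: prod_eq_iff)
  let ?V = "verts (double_point_graph f T)"
  define s where "s p \<longleftrightarrow> h (axis (fst p) 1) < h (axis (snd p) 1)" for p :: "'a \<times> 'a"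
  have s_swap: "s (prod.swap p) \<longleftrightarrow> \<not> s p" if "p \<in> ?V" for p
  proof -
    obtain a b where ab: "p = (a, b)" "a \<in> verts T" "b \<in> verts T" "a \<noteq> b" "f a = f b"
      using \<open>p \<in> ?V\<close> double_point_verts[of _ _ f T] by (cases p) auto
    have "h (axis a 1) \<noteq> h (axis b 1)"
      using inj_h[of "axis a 1" "axis b 1"] vertex_in_realisation[of _ T] ab
      by (auto simp: realisation_map_axis axis_eq_axis)
    then show ?thesis unfolding s_def ab(1) by auto
  qed
  have s_step: "s p \<longrightarrow> s q" if pq: "{p, q} \<in> edges (double_point_graph f T)" for p q
  proof
    assume sp: "s p"
    show "s q"
    proof (rule ccontr)
      assume sq: "\<not> s q"
      obtain a b a' b' where pq': "p = (a, b)" "q = (a', b')" by (cases p; cases q) auto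
      have V: "a \<noteq> b" "a' \<noteq> b'" "f a = f b" "f a' = f b'" and e: "{a, a'} \<in> edges T" "{b, b'} \<in> edges T"
        using pq unfolding double_point_edges pq' double_point_verts by auto
      define k where "k t = h (edge_point a a' t) - h (edge_point b b' t)" for t
      have cont: "continuous_on {0..1} (\<lambda>t. h (edge_point u v t))" if "{u, v} \<in> edges T" for u v
      proof (rule continuous_on_compose2[OF h])
        show "continuous_on {0..1} (edge_point u v)"
          unfolding edge_point_def by (intro continuous_intros)
        show "edge_point u v ` {0..1} \<subseteq> realisation T"
          using edge_point_in_realisation[OF that] by auto
      qed
      have "continuous_on {0..1} k"
        unfolding k_def using cont[OF e(1)] cont[OF e(2)] by (rule continuous_on_diff)
      moreover have "k 0 \<le> 0" "0 \<le> k 1"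
        using sp sq unfolding s_def pq' k_def by (auto simp: edge_point_def)
      ultimately obtain t where t: "0 \<le> t" "t \<le> 1" "k t = 0"
        using IVT'[of k 0 0 1] by auto
      have eq: "edge_point a a' t = edge_point b b' t"
        using inj_h[OF edge_point_in_realisation[OF e(1) t(1,2)] edge_point_in_realisation[OF e(2) t(1,2)]] t(3) V
        unfolding k_def by (simp add: realisation_map_edge_point)
      \<comment> \<open>At an end, a common point identifies the two vertices of a pair. In the
        interior the edges agree, either in order, giving \<open>a = b\<close>, or reversed, giving
        \<open>a' = b\<close> and so \<open>f a = f a'\<close>.\<close>
      consider "t = 0" | "t = 1" | "0 < t" "t < 1" using t by linarith
      then show False
      proof cases
        case 3
        then show False
          using edge_point_eq[OF eq] inj[OF e(1)] inj[OF e(2)] V by metis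
      qed (use eq V in \<open>auto simp: edge_point_def axis_eq_axis\<close>)
    qed
  qed
  have s_path: "s (hd p) \<longrightarrow> s (last p)"
    if "p \<noteq> []" "successively (\<lambda>u v. {u, v} \<in> edges (double_point_graph f T)) p" for p
    using that
  proof (induction p)
    case (Cons a p)
    then show ?case using s_step[of a "hd p"] by (cases "p = []") (auto simp: successively_Cons)
  qed simp
  have p: "q \<in> ?V" "p \<noteq> []" "successively (\<lambda>u v. {u, v} \<in> edges (double_point_graph f T)) p"
    "hd p = q" "last p = prod.swap q"
    using obs unfolding two_obstructor_def edge_path_def by auto
  \<comment> \<open>\<open>s_step\<close> is one implication only; the reversed path supplies the
    other, needed when \<open>s\<close> fails at the start.\<close>
  have "successively (\<lambda>u v. {u, v} \<in> edges (double_point_graph f T)) (rev p)"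
    using p(3) by (simp add: insert_commute)
  then have "s (last p) \<longrightarrow> s (hd p)" using s_path[of "rev p"] p(2) by (simp add: hd_rev last_rev)
  then show False using s_path[OF p(2,3)] s_swap[OF p(1)] p(4,5) by auto
qed

theorem theorem11:
  fixes T :: "'a::finite graph" and J :: "'b::finite graph" and f :: "'a \<Rightarrow> 'b"
  assumes "tree_graph T"
    and "path_graph J"
    and "simplicial_map f T J"
    and "stable_map f T J"
  shows "(\<nexists>x p. two_obstructor f T x p) \<longleftrightarrow> lifts_to_embedding f T J"
proof
  have T: "simple_graph T" using assms(1) unfolding tree_graph_def by blast
  note edge = stable_map_edge[OF T assms(2-4)]
  show "\<nexists>x p. two_obstructor f T x p" if "lifts_to_embedding f T J"
    using lift_no_two_obstructor[OF edge(1) that] by blast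
  assume no: "\<nexists>x p. two_obstructor f T x p"
  obtain pos :: "'b \<Rightarrow> int" where pos: "inj_on pos (verts J)"
    "\<And>u v. {u, v} \<in> edges J \<Longrightarrow> pos v = pos u + 1 \<or> pos v = pos u - 1"
    using path_graph_levels[OF assms(2)] by metis
  define adj where "adj u v \<longleftrightarrow> {u, v} \<in> edges T" for u v
  define lev where "lev v = pos (f v)" for v
  interpret level_graph adj lev
  proof
    show "adj v u" if "adj u v" for u v using that by (simp add: adj_def insert_commute)
    show "lev v = lev u + 1 \<or> lev v = lev u - 1" if "adj u v" for u v
      using pos(2)[OF edge(2)] that unfolding adj_def lev_def by blast
  qed
  have lev_eq: "lev a = lev b \<longleftrightarrow> f a = f b" if "a \<in> verts T" "b \<in> verts T" for a b
    unfolding lev_def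
    using inj_on_eq_iff[OF pos(1)] simplicial_vertex[OF assms(2,3)] that by simp
  have verts: "u \<in> verts T" "v \<in> verts T" if "adj u v" for u v
    using that T unfolding simple_graph_def adj_def by auto
  let ?G = "double_point_graph f T"
  have step: "{p, q} \<in> edges ?G" if "pair_step p q" for p q
    using that verts lev_eq unfolding pair_step_def
    by (cases p; cases q) (auto simp: double_point_edges double_point_verts adj_def)
  have walk: "\<exists>ps. edge_path ?G ps \<and> hd ps = p \<and> last ps = q" if "pair_step\<^sup>*\<^sup>* p q" "p \<in> verts ?G" for p q
    using that(1)
  proof (induction rule: rtranclp_induct)
    case base
    show ?case using that(2) by (intro exI[of _ "[p]"]) (simp add: edge_path_def)
  next
    case (step q s)
    then obtain ps where ps: "edge_path ?G ps" "hd ps = p" "last ps = q" by blast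
    have "{q, s} \<in> edges ?G" using \<open>\<And>p q. pair_step p q \<Longrightarrow> {p, q} \<in> edges ?G\<close> step(2) .
    then have "edge_path ?G (ps @ [s])"
      using ps unfolding edge_path_def double_point_edges by (auto simp: successively_append_iff double_point_edges)
    then show ?case using ps unfolding edge_path_def by (intro exI[of _ "ps @ [s]"]) auto
  qed
  have no_loop: "\<not> pair_step\<^sup>*\<^sup>* (a, b) (b, a)" if "a \<noteq> b" for a b
  proof
    assume path: "pair_step\<^sup>*\<^sup>* (a, b) (b, a)"
    \<comment> \<open>Elements of the type outside \<open>verts T\<close> carry arbitrary levels.
      The first move of the loop runs along edges of \<open>T\<close>, which makes
      \<open>(a, b)\<close> a vertex of the double point graph.\<close>
    then have "\<exists>q. pair_step (a, b) q"
    proof (cases rule: converse_rtranclpE)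
      case base
      then show ?thesis using \<open>a \<noteq> b\<close> by simp
    qed blast
    then have "(a, b) \<in> verts ?G" using step double_point_edges by blast
    then show False using walk[OF path] no unfolding two_obstructor_def by auto
  qed
  obtain x where "signing x" using ex_signing[OF no_loop] by blast
  from ex_rank[OF this] obtain r :: "'a \<Rightarrow> nat" where
    r: "\<forall>a b. a \<noteq> b \<longrightarrow> lev a = lev b \<longrightarrow> r a \<noteq> r b" "signing (\<lambda>a b. r a < r b)"
    by (elim exE conjE)
  show "lifts_to_embedding f T J"
  proof (rule lift_of_ranks[OF T assms(3) edge(1), where r = "\<lambda>v. real (r v)"])
    show "real (r u) \<noteq> real (r v)" if "u \<noteq> v" "f u = f v" for u v
      using r(1) that by (simp add: lev_def)
    show "real (r u) < real (r v) \<longleftrightarrow> real (r u') < real (r v')"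
      if "{u, u'} \<in> edges T" "{v, v'} \<in> edges T" "u \<noteq> v" "u' \<noteq> v'" "f u = f v" "f u' = f v'" for u v u' v'
      using signing_step[OF r(2), of u v u' v'] that by (simp add: adj_def lev_def)
  qed
qed

end
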